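(* Let $\varphi:\mathbb{P}^N_{\mathbb{Q}}\to\mathbb{P}^N_{\mathbb{Q}}$ be a morphism of degree $d$ defined over $\mathbb{Q}$, and let $P\in\mathbb{P}^N(\mathbb{Q})$ be a point whose forward orbit $\mathcal{O}_\varphi(P)=\{P,\varphi(P),\varphi^2(P),\dots\}$ is infinite. For each prime $p$ let $m_p(\varphi,P)$ be the size of the orbit of $P$ modulo $p$. Then: (a) For all $\gamma<1$, $$\boldsymbol{\delta}\bigl\{p : m_p(\varphi,P)\ge(\log p)^\gamma\bigr\}=1 .$$ (b) There is a constant $C=C(N,\varphi,P)$ such that for all $\epsilon>0$, $$\underline{\boldsymbol{\delta}}\bigl\{p : m_p(\varphi,P)\ge\epsilon\log p\bigr\}\ge 1-C\epsilon .$$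
   Context: Orbit size modulo $p$: for all but finitely many primes $p$, the map $\varphi$ (written with homogeneous polynomials with coprime integer coefficients) can be reduced modulo $p$ to give a morphism $\tilde\varphi_p:\mathbb{P}^N_{\mathbb{F}_p}\to\mathbb{P}^N_{\mathbb{F}_p}$ whose degree is still $d$. For such $p$, $m_p(\varphi,P)=\#\mathcal{O}_{\tilde\varphi_p}(\tilde P)$ is the number of elements in the forward $\tilde\varphi_p$-orbit of the reduced point $\tilde P=P \bmod p\in\mathbb{P}^N(\mathbb{F}_p)$. For the remaining finitely many primes, $m_p(\varphi,P)=\infty$. Density: for a set $\mathcal{P}$ of prime numbers put $\zeta(\mathcal{P},s)=\prod_{p\in\mathcal{P}}(1-p^{-s})^{-1}$ for $\operatorname{Re}(s)>1$, and let $\zeta(s)$ be the Riemann zeta function. The (logarithmic analytic) density of $\mathcal{P}$ is $$\boldsymbol{\delta}(\mathcal{P})=\lim_{s\to1^+}\frac{\zeta'(\mathcal{P},s)/\zeta(\mathcal{P},s)}{\zeta'(s)/\zeta(s)}=\lim_{s\to1^+}(s-1)\sum_{p\in\mathcal{P}}\frac{\log p}{p^s},$$ when the limit exists; the lower density $\underline{\boldsymbol{\delta}}(\mathcal{P})$ is defined by the same formula with $\lim$ replaced by $\liminf$. A statement $\boldsymbol{\delta}(\mathcal{P})=1$ includes the assertion that the limit exists. *)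

theory Defs
  imports
    "HOL-Analysis.Analysis"
    "HOL-Algebra.Algebraic_Closure"
    "HOL-Algebra.Algebraic_Closure_Type"
    "HOL-Number_Theory.Residues"
    "HOL-Library.Poly_Mapping"
begin

text \<open>
  A polynomial maps exponent vectors to coefficients; the variables are \<open>X\<^sub>0, X\<^sub>1, \<dots>\<close>.
\<close>

type_synonym 'a mpoly = "(nat \<Rightarrow>\<^sub>0 nat) \<Rightarrow>\<^sub>0 'a"

text \<open>
  Value in the ring \<open>K\<close> of a polynomial whose coefficients are sent to \<open>K\<close> by \<open>h\<close>.
\<close>

definition mpoly_eval ::
  "('b, 'm) ring_scheme \<Rightarrow> ('a::zero \<Rightarrow> 'b) \<Rightarrow> 'a mpoly \<Rightarrow> (nat \<Rightarrow> 'b) \<Rightarrow> 'b" where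
  "mpoly_eval K h f x =
     (\<Oplus>\<^bsub>K\<^esub>m\<in>Poly_Mapping.keys f.
        h (Poly_Mapping.lookup f m) \<otimes>\<^bsub>K\<^esub>
        (\<Otimes>\<^bsub>K\<^esub>i\<in>Poly_Mapping.keys m. x i [^]\<^bsub>K\<^esub> Poly_Mapping.lookup m i))"

definition homogeneous_mpoly :: "nat \<Rightarrow> nat \<Rightarrow> 'a::zero mpoly \<Rightarrow> bool" where
  "homogeneous_mpoly N d f \<longleftrightarrow>
     (\<forall>m\<in>Poly_Mapping.keys f. Poly_Mapping.keys m \<subseteq> {..N} \<and>
        (\<Sum>i\<in>Poly_Mapping.keys m. Poly_Mapping.lookup m i) = d)"

definition proj_coords :: "nat \<Rightarrow> ('a, 'm) ring_scheme \<Rightarrow> (nat \<Rightarrow> 'a) set" where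
  "proj_coords N K = {x \<in> {..N} \<rightarrow>\<^sub>E carrier K. \<exists>i\<le>N. x i \<noteq> \<zero>\<^bsub>K\<^esub>}"

definition proj_rel :: "nat \<Rightarrow> ('a, 'm) ring_scheme \<Rightarrow> ((nat \<Rightarrow> 'a) \<times> (nat \<Rightarrow> 'a)) set" where
  "proj_rel N K = {(x, y). x \<in> proj_coords N K \<and> y \<in> proj_coords N K \<and>
     (\<exists>c\<in>carrier K - {\<zero>\<^bsub>K\<^esub>}. \<forall>i\<le>N. y i = c \<otimes>\<^bsub>K\<^esub> x i)}"

definition proj_space :: "nat \<Rightarrow> ('a, 'm) ring_scheme \<Rightarrow> (nat \<Rightarrow> 'a) set set" where
  "proj_space N K = proj_coords N K // proj_rel N K"

text \<open>
  \<open>[F\<^sub>0 : \<dots> : F\<^sub>N]\<close> is a morphism of degree \<open>d\<close> over the field \<open>K\<close>: the \<open>F\<^sub>i\<close> are forms of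
  degree \<open>d\<close> over \<open>K\<close> without common zero in projective space over the algebraic closure.
  The map \<open>ring.indexed_const K\<close> is the embedding of \<open>K\<close> into its algebraic closure.
\<close>

definition proj_morphism :: "nat \<Rightarrow> nat \<Rightarrow> 'a::zero ring \<Rightarrow> (nat \<Rightarrow> 'a mpoly) \<Rightarrow> bool" where
  "proj_morphism N d K F \<longleftrightarrow>
     (\<forall>i\<le>N. homogeneous_mpoly N d (F i) \<and> Poly_Mapping.range (F i) \<subseteq> carrier K) \<and>
     (\<forall>x\<in>proj_coords N (field.alg_closure K).
        \<exists>i\<le>N. mpoly_eval (field.alg_closure K) (ring.indexed_const K) (F i) x
              \<noteq> \<zero>\<^bsub>field.alg_closure K\<^esub>)"

text \<open>
  The image of a point, which is a class of coordinate vectors, is the class of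
  \<open>(F\<^sub>0(x), \<dots>, F\<^sub>N(x))\<close> for the \<open>x\<close> in it; by homogeneity all \<open>x\<close> give the same class.
\<close>

definition proj_map ::
  "nat \<Rightarrow> 'a::zero ring \<Rightarrow> (nat \<Rightarrow> 'a mpoly) \<Rightarrow> (nat \<Rightarrow> 'a) set \<Rightarrow> (nat \<Rightarrow> 'a) set" where
  "proj_map N K F Q =
     proj_rel N K `` ((\<lambda>x. \<lambda>i\<in>{..N}. mpoly_eval K id (F i) x) ` Q)"

definition forward_orbit :: "('a \<Rightarrow> 'a) \<Rightarrow> 'a \<Rightarrow> 'a set" where
  "forward_orbit f x = {(f ^^ n) x | n. True}"

abbreviation rat_field :: "rat ring" where
  "rat_field \<equiv> ring_of_type_algebra"

abbreviation prime_field :: "nat \<Rightarrow> int ring" where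
  "prime_field p \<equiv> residue_ring (int p)"

text \<open>
  \<open>[G\<^sub>0 : \<dots> : G\<^sub>N]\<close> is the map \<open>[F\<^sub>0 : \<dots> : F\<^sub>N]\<close> written with integer coefficients that are
  jointly coprime.  Every nonzero \<open>F\<close> has exactly two such \<open>G\<close>, on the indices up to \<open>N\<close>,
  and they differ by sign.
\<close>

definition primitive_model :: "nat \<Rightarrow> (nat \<Rightarrow> rat mpoly) \<Rightarrow> (nat \<Rightarrow> int mpoly) \<Rightarrow> bool" where
  "primitive_model N F G \<longleftrightarrow>
     (\<exists>c::rat. c \<noteq> 0 \<and> (\<forall>i\<le>N. F i = Poly_Mapping.map (\<lambda>a. c * of_int a) (G i))) \<and>
     Gcd (\<Union>i\<le>N. Poly_Mapping.range (G i)) = 1"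

definition reduce_map :: "nat \<Rightarrow> nat \<Rightarrow> (nat \<Rightarrow> rat mpoly) \<Rightarrow> nat \<Rightarrow> int mpoly" where
  "reduce_map p N F =
     (\<lambda>i. Poly_Mapping.map (\<lambda>a. a mod int p) ((SOME G. primitive_model N F G) i))"

text \<open>
  The class over \<open>\<F>\<^sub>p\<close> of \<open>(a\<^sub>0 mod p, \<dots>, a\<^sub>N mod p)\<close>, for coprime integer coordinates
  \<open>a\<^sub>0, \<dots>, a\<^sub>N\<close> of the point.  These are unique up to a common sign.
\<close>

definition reduce_point :: "nat \<Rightarrow> nat \<Rightarrow> (nat \<Rightarrow> rat) set \<Rightarrow> (nat \<Rightarrow> int) set" where
  "reduce_point p N P = proj_rel N (prime_field p) ``
     {(\<lambda>i\<in>{..N}. a i mod int p) | a. Gcd (a ` {..N}) = 1 \<and> (\<lambda>i\<in>{..N}. of_int (a i)) \<in> P}"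

definition orbit_size_mod ::
  "nat \<Rightarrow> nat \<Rightarrow> (nat \<Rightarrow> rat mpoly) \<Rightarrow> (nat \<Rightarrow> rat) set \<Rightarrow> nat \<Rightarrow> enat" where
  "orbit_size_mod N d F P p =
     (if proj_morphism N d (prime_field p) (reduce_map p N F)
      then enat (card (forward_orbit (proj_map N (prime_field p) (reduce_map p N F))
                                     (reduce_point p N P)))
      else \<infinity>)"

text \<open>
  Zeta functions for real \<open>s > 1\<close>; the densities are limits along the real axis, where the
  real derivative agrees with the complex one.
\<close>

definition zeta_of :: "nat set \<Rightarrow> real \<Rightarrow> real" where
  "zeta_of A s = prodinf (\<lambda>p. if p \<in> A then inverse (1 - real p powr (- s)) else 1)"

definition riemann_zeta :: "real \<Rightarrow> real" where
  "riemann_zeta s = suminf (\<lambda>n. 1 / real (Suc n) powr s)"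

definition log_deriv_ratio :: "nat set \<Rightarrow> real \<Rightarrow> real" where
  "log_deriv_ratio A s =
     (deriv (zeta_of A) s / zeta_of A s) / (deriv riemann_zeta s / riemann_zeta s)"

definition has_density :: "nat set \<Rightarrow> real \<Rightarrow> bool" where
  "has_density A l \<longleftrightarrow> (log_deriv_ratio A \<longlongrightarrow> l) (at_right 1)"

definition lower_density :: "nat set \<Rightarrow> ereal" where
  "lower_density A = Liminf (at_right 1) (\<lambda>s. ereal (log_deriv_ratio A s))"

end

theory Submission
  imports Defs
begin

text \<open>
  Write the orbit of \<open>P\<close> with integer vectors: start with coprime coordinates \<open>u\<^sub>0\<close> of \<open>P\<close> and
  put \<open>u\<^sub>n\<^sub>+\<^sub>1 = G(u\<^sub>n)\<close> for a primitive integer model \<open>G\<close> of the map, without ever cancelling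
  common factors.  Since the orbit is infinite, no \<open>u\<^sub>n\<close> vanishes and no two are proportional,
  so each pair \<open>m < n\<close> has a nonzero \<open>2 \<times> 2\<close> minor.  Let \<open>D(M)\<close> be the product of such minors
  over \<open>m < n \<le> M + 1\<close>.  If a prime \<open>p\<close> does not divide \<open>D(M)\<close>, then the \<open>u\<^sub>n\<close> with \<open>n \<le> M + 1\<close>
  stay nonzero and pairwise non-proportional modulo \<open>p\<close>, and the orbit modulo \<open>p\<close> has more
  than \<open>M\<close> elements (\<open>orbit_size_mod_ge\<close>).  A form of degree \<open>d\<close> multiplies logarithmic heights
  by at most about \<open>d\<close>, so the entries of \<open>u\<^sub>n\<close> are at most doubly exponential in \<open>n\<close> and
  \<open>ln D(M) \<le> K R\<^sup>M\<close> for some \<open>K\<close> and \<open>R > 1\<close> (\<open>collision_numbers\<close>).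

  A prime with orbit size \<open>M\<close> therefore divides \<open>D(M)\<close>, and the sum of \<open>ln p\<close> over these primes
  is at most \<open>K R\<^sup>M\<close>.  If moreover \<open>M < \<epsilon> ln p\<close>, then \<open>1/p < exp (- M/\<epsilon>)\<close>.  Hence the sum of
  \<open>ln p / p\<close> over all primes whose orbit size is below \<open>\<epsilon> ln p\<close> is at most
  \<open>\<Sum>\<^sub>M K (R exp (- 1/\<epsilon>))\<^sup>M\<close>, which converges as soon as \<open>\<epsilon> ln R < 1\<close>
  (\<open>summable_primes_with_small_value\<close>).

  The Euler product turns the logarithmic derivative of the zeta function of a set of primes
  into \<open>- \<Sum> ln p / (p\<^sup>s - 1)\<close>, and over all primes this sum tends to infinity as \<open>s\<close> decreases to
  \<open>1\<close>.  A set of primes with convergent \<open>\<Sum> ln p / p\<close> is thus negligible, and its complement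
  has density \<open>1\<close> (\<open>log_deriv_ratio_tendsto_1\<close>).  Part (a) follows because
  \<open>(ln p)\<^sup>\<gamma> \<le> \<epsilon> ln p\<close> for large \<open>p\<close>.  In part (b) the constant is \<open>C = ln R\<close>: for
  \<open>\<epsilon> < 1/C\<close> the density is even \<open>1\<close>, and for larger \<open>\<epsilon>\<close> the bound is not positive.
\<close>

section \<open>Logarithmic derivatives of Euler products\<close>

text \<open>
  Minus the logarithmic derivative of the Euler product over \<open>A\<close>; the terms are
  \<open>\<Sum>\<^sub>k\<^sub>\<ge>\<^sub>1 ln p / p\<^sup>k\<^sup>s\<close> in closed form.
\<close>

definition prime_log_sum :: "nat set \<Rightarrow> real \<Rightarrow> real" where
  "prime_log_sum A s = suminf (\<lambda>p. if p \<in> A then ln (real p) / (real p powr s - 1) else 0)"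

definition euler_log :: "nat set \<Rightarrow> real \<Rightarrow> real" where
  "euler_log A s = suminf (\<lambda>p. if p \<in> A then - ln (1 - real p powr (- s)) else 0)"

lemma powr_ge_2: "n \<ge> 2 \<Longrightarrow> s \<ge> 1 \<Longrightarrow> real n powr s \<ge> 2"
  using powr_mono[of 1 s "real n"] by (simp del: powr_mono)

lemma powr_neg_le_half: 
  assumes "n \<ge> 2" "s \<ge> 1"
  shows "real n powr - s \<le> 1 / 2"
  using le_imp_inverse_le[OF powr_ge_2[OF assms]] by (simp add: powr_minus)

text \<open>
  Up to a factor \<open>2\<close> the closed form may be traded for the leading term \<open>ln p / p\<^sup>s\<close>.  The upper
  bound gives convergence, the lower bound gives divergence at \<open>s = 1\<close>.
\<close>

lemma log_term_bounds:
  assumes "n \<ge> 2" "s \<ge> 1"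
  shows "0 \<le> ln (real n) / (real n powr s - 1)"
    and "ln (real n) / (real n powr s - 1) \<le> 2 * (ln (real n) * real n powr - s)"
    and "ln (real n) * real n powr - s \<le> ln (real n) / (real n powr s - 1)"
proof -
  have x: "real n powr s \<ge> 2" using powr_ge_2[OF assms] .
  have l: "ln (real n) \<ge> 0" using assms by simp
  show "0 \<le> ln (real n) / (real n powr s - 1)" using x l by simp
  have "ln (real n) / (real n powr s - 1) \<le> ln (real n) / (real n powr s / 2)"
    using x l assms by (intro divide_left_mono) (auto intro!: mult_pos_pos)
  thus "ln (real n) / (real n powr s - 1) \<le> 2 * (ln (real n) * real n powr - s)"
    by (simp add: powr_minus field_simps)
  have "ln (real n) / real n powr s \<le> ln (real n) / (real n powr s - 1)"
    using x l assms by (intro divide_left_mono) (auto intro!: mult_pos_pos)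
  thus "ln (real n) * real n powr - s \<le> ln (real n) / (real n powr s - 1)"
    by (simp add: powr_minus field_simps)
qed

lemma euler_term_bounds:
  assumes "n \<ge> 2" "s \<ge> 1"
  shows "0 \<le> - ln (1 - real n powr (- s))"
    and "- ln (1 - real n powr (- s)) \<le> 2 * real n powr - s"
proof -
  define x where "x = real n powr - s"
  have x: "0 < x" "x \<le> 1/2"
    using powr_ge_2[OF assms] assms by (auto simp: x_def powr_minus field_simps)
  show "0 \<le> - ln (1 - real n powr (- s))" using x by (simp add: x_def)
  have "- x - 2 * x^2 \<le> ln (1 - x)" using x by (intro ln_one_minus_pos_lower_bound) auto
  moreover have "2 * x^2 \<le> x" using x by (simp add: power2_eq_square)
  ultimately show "- ln (1 - real n powr (- s)) \<le> 2 * real n powr - s"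
    by (simp add: x_def)
qed

lemma summable_log_powr:
  assumes "a > (1::real)"
  shows "summable (\<lambda>n. ln (real n) * real n powr - a)"
proof -
  define b where "b = (a - 1) / 2"
  have b: "b > 0" using assms by (simp add: b_def)
  have "summable (\<lambda>n. real n powr (- 1 - b) * (1 / b))"
    using b by (intro summable_mult2) (simp add: summable_real_powr_iff)
  moreover have "norm (ln (real n) * real n powr - a) \<le> real n powr (- 1 - b) * (1 / b)" for n
  proof (cases "n = 0")
    case False
    hence "ln (real n) \<le> real n powr b / b" using b by (intro ln_powr_bound) auto
    hence "ln (real n) * real n powr - a \<le> real n powr b / b * real n powr - a"
      by (intro mult_right_mono) auto
    also have "\<dots> = real n powr (b - a) * (1/b)" by (simp add: powr_add [symmetric])
    also have "b - a = - 1 - b" by (simp add: b_def field_simps)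
    finally show ?thesis using False by simp
  qed simp
  ultimately show ?thesis by (rule summable_comparison_test'[where N = 0])
qed

lemma summable_prime_log_sum:
  assumes "A \<subseteq> {2..}" "s > 1"
  shows "summable (\<lambda>p. if p \<in> A then ln (real p) / (real p powr s - 1) else 0)"
proof (rule summable_comparison_test')
  show "summable (\<lambda>p. 2 * (ln (real p) * real p powr - s))"
    using summable_log_powr[OF assms(2)] by (rule summable_mult)
  show "norm (if p \<in> A then ln (real p) / (real p powr s - 1) else 0)
          \<le> 2 * (ln (real p) * real p powr - s)" if "p \<ge> 1" for p
  proof (cases "p \<in> A")
    case True
    hence "p \<ge> 2" using assms by auto
    thus ?thesis using log_term_bounds[of p s] assms True by (simp add: abs_of_nonneg del: abs_divide)
  qed (use that in auto)
qed

lemma summable_euler_log: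
  assumes "A \<subseteq> {2..}" "s > 1"
  shows "summable (\<lambda>p. if p \<in> A then - ln (1 - real p powr (- s)) else 0)"
proof (rule summable_comparison_test')
  show "summable (\<lambda>p. 2 * real p powr - s)"
    using assms by (intro summable_mult) (simp add: summable_real_powr_iff)
  show "norm (if p \<in> A then - ln (1 - real p powr (- s)) else 0) \<le> 2 * real p powr - s" for p
  proof (cases "p \<in> A")
    case True
    hence "p \<ge> 2" using assms by auto
    thus ?thesis using euler_term_bounds[of p s] assms True by simp
  qed auto
qed

lemma zeta_of_eq_exp:
  assumes "A \<subseteq> {2..}" "s > 1"
  shows "zeta_of A s = exp (euler_log A s)"
proof -
  have "(if p \<in> A then inverse (1 - real p powr (- s)) else 1) =
      exp (if p \<in> A then - ln (1 - real p powr (- s)) else 0)" for p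
  proof (cases "p \<in> A")
    case True
    hence "p \<ge> 2" using assms by auto
    hence "real p powr - s < 1" 
      using powr_neg_le_half[of p s] assms by auto
    thus ?thesis using True by (simp add: exp_minus)
  qed auto
  thus ?thesis unfolding zeta_of_def euler_log_def
    by (simp add: prodinf_exp[OF summable_euler_log[OF assms]])
qed

text \<open>
  Termwise differentiation needs uniform convergence near \<open>s\<close>.  The derivatives decrease in \<open>s\<close>,
  so on a half-line from a point strictly between \<open>1\<close> and \<open>s\<close> they are dominated by their size
  at that point.
\<close>

lemma euler_log_deriv:
  assumes "A \<subseteq> {2..}" "s > 1"
  shows "(euler_log A has_field_derivative - prime_log_sum A s) (at s)"
proof -
  define a where "a = (1 + s) / 2"
  have a: "1 < a" "a < s" using assms by (auto simp: a_def)
  define f where "f = (\<lambda>p s. if p \<in> A then - ln (1 - real p powr (- s)) else 0)"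
  define f' where "f' = (\<lambda>p s. - (if p \<in> A then ln (real p) / (real p powr s - 1) else 0))"
  have "((\<lambda>x. suminf (\<lambda>n. f n x)) has_field_derivative suminf (\<lambda>n. f' n s)) (at s)"
  proof (rule has_field_derivative_series'(2))
    show "convex {a..}" by simp
    show "s \<in> {a..}" "s \<in> interior {a..}" using a by auto
    show "summable (\<lambda>n. f n s)" unfolding f_def by (rule summable_euler_log[OF assms])
    show "uniformly_convergent_on {a..} (\<lambda>n x. \<Sum>i<n. f' i x)"
    proof (rule Weierstrass_m_test')
      show "summable (\<lambda>p. 2 * (ln (real p) * real p powr - a))"
        using summable_log_powr[OF a(1)] by (rule summable_mult)
      fix p x assume x: "x \<in> {a..}"
      show "norm (f' p x) \<le> 2 * (ln (real p) * real p powr - a)"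
      proof (cases "p \<in> A")
        case True
        hence p: "p \<ge> 2" using assms by auto
        have "norm (f' p x) \<le> 2 * (ln (real p) * real p powr - x)"
          using True p x a log_term_bounds[of p x] by (simp add: f'_def abs_of_nonneg del: abs_divide)
        also have "\<dots> \<le> 2 * (ln (real p) * real p powr - a)"
          using p x by (intro mult_left_mono powr_mono) auto
        finally show ?thesis .
      next
        case False
        have "ln (real p) \<ge> 0" by (cases "p = 0") auto
        thus ?thesis using False by (auto simp: f'_def)
      qed
    qed
    fix p x assume x: "x \<in> {a..}"
    show "(f p has_field_derivative f' p x) (at x within {a..})"
    proof (cases "p \<in> A")
      case True
      hence p: "p \<ge> 2" using assms by auto
      have q: "real p powr x \<ge> 2" using powr_ge_2[of p x] p x a by auto
      have "real p powr - x < 1" using powr_neg_le_half[of p x] p x a by auto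
      hence l: "1 - real p powr - x > 0" by simp
      have "((\<lambda>x. real p powr - x) has_field_derivative - (ln (real p) * real p powr - x))
              (at x within {a..})"
      proof (rule has_field_derivative_at_within)
        have "real p > 0" using p by simp
        from DERIV_powr[OF DERIV_const this DERIV_minus[OF DERIV_ident], of x]
        show "((\<lambda>x. real p powr - x) has_field_derivative - (ln (real p) * real p powr - x)) (at x)"
          by (rule DERIV_cong) simp
      qed
      hence "((\<lambda>x. 1 - real p powr - x) has_field_derivative
              0 - - (ln (real p) * real p powr - x)) (at x within {a..})"
        by (intro DERIV_diff DERIV_const)
      from DERIV_minus[OF DERIV_chain'[OF this DERIV_ln[OF l]]]
      have "((\<lambda>x. - ln (1 - real p powr - x)) has_field_derivative
              - (inverse (1 - real p powr - x) * (0 - - (ln (real p) * real p powr - x))))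
            (at x within {a..})" .
      moreover have "- (inverse (1 - real p powr - x) * (0 - - (ln (real p) * real p powr - x))) = f' p x"
      proof -
        have "- (inverse (1 - inverse u) * (0 - - (l * inverse u))) = - (l / (u - 1))"
          if "u \<ge> 2" for u l :: real
          using that by (simp add: field_simps)
        from this[OF q] show ?thesis using True by (simp add: f'_def powr_minus)
      qed
      ultimately have "((\<lambda>x. - ln (1 - real p powr - x)) has_field_derivative f' p x) (at x within {a..})"
        by simp
      thus ?thesis using True by (simp add: f_def)
    qed (auto simp: f_def f'_def)
  qed
  moreover have "suminf (\<lambda>n. f' n s) = - prime_log_sum A s"
    unfolding f'_def prime_log_sum_def
    by (intro suminf_minus summable_prime_log_sum assms)
  ultimately show ?thesis by (simp add: f_def euler_log_def [abs_def])
qed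

lemma zeta_of_log_deriv:
  assumes "A \<subseteq> {2..}" "s > 1"
  shows "deriv (zeta_of A) s / zeta_of A s = - prime_log_sum A s"
proof -
  have d: "((\<lambda>s. exp (euler_log A s)) has_real_derivative
          exp (euler_log A s) * - prime_log_sum A s) (at s)"
    by (rule DERIV_chain2[OF DERIV_exp euler_log_deriv[OF assms]])
  have "eventually (\<lambda>t. t \<in> {1<..}) (nhds s)"
    using assms by (intro eventually_nhds_in_open) auto
  hence ev: "eventually (\<lambda>t. exp (euler_log A t) = zeta_of A t) (nhds s)"
    by eventually_elim (simp add: zeta_of_eq_exp[OF assms(1)])
  have "(zeta_of A has_real_derivative exp (euler_log A s) * - prime_log_sum A s) (at s)"
    by (rule iffD1[OF DERIV_cong_ev[OF refl ev refl] d])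
  thus ?thesis by (simp add: DERIV_imp_deriv zeta_of_eq_exp assms)
qed

abbreviation primes :: "nat set" where "primes \<equiv> {p. Factorial_Ring.prime p}"

lemma primes_ge_2: "primes \<subseteq> {2..}" by (auto dest: prime_ge_2_nat)

text \<open>
  The numbers that survive the sieve of Eratosthenes by the primes below \<open>k\<close>.
\<close>

definition sieved :: "nat \<Rightarrow> nat set" where
  "sieved k = {n. n > 0 \<and> (\<forall>p<k. Factorial_Ring.prime p \<longrightarrow> \<not> p dvd n)}"

lemma powr_summable_on:
  assumes "s > 1"
  shows "(\<lambda>n. real n powr - s) summable_on B"
proof -
  have "(\<lambda>n. real n powr - s) summable_on UNIV"
    using assms by (intro norm_summable_imp_summable_on) (simp add: summable_real_powr_iff)
  thus ?thesis by (rule summable_on_subset) auto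
qed

lemma riemann_zeta_eq_infsum:
  assumes "s > 1"
  shows "riemann_zeta s = infsum (\<lambda>n. real n powr - s) {0<..}"
proof -
  have sm: "summable (\<lambda>n. real n powr - s)" using assms by (simp add: summable_real_powr_iff)
  have "suminf (\<lambda>n. real n powr - s) = suminf (\<lambda>n. real (Suc n) powr - s)"
    using suminf_split_head[OF sm] by simp
  moreover have "infsum (\<lambda>n. real n powr - s) UNIV = suminf (\<lambda>n. real n powr - s)"
    using sm by (intro infsumI norm_summable_imp_has_sum summable_sums) auto
  moreover have "infsum (\<lambda>n. real n powr - s) UNIV = infsum (\<lambda>n. real n powr - s) {0<..}"
    by (intro infsum_cong_neutral) auto
  ultimately show ?thesis by (simp add: riemann_zeta_def powr_minus divide_simps)
qed

text \<open>
  Split \<open>sieved k\<close> into the multiples of \<open>k\<close> and the rest.  The multiples are exactly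
  \<open>k \<cdot> sieved k\<close>, so they carry the fraction \<open>k\<^sup>-\<^sup>s\<close> of the whole sum.
\<close>

lemma sieve_step:
  assumes "s > 1" "Factorial_Ring.prime k"
  shows "infsum (\<lambda>n. real n powr - s) (sieved k) * (1 - real k powr - s) =
         infsum (\<lambda>n. real n powr - s) (sieved (Suc k))"
proof -
  let ?f = "\<lambda>n. real n powr - s"
  have k0: "k > 0" using assms by (simp add: prime_gt_0_nat)
  have "sieved k = sieved (Suc k) \<union> (\<lambda>n. k * n) ` sieved k"
  proof (intro equalityI subsetI)
    fix n assume n: "n \<in> sieved k"
    show "n \<in> sieved (Suc k) \<union> (\<lambda>n. k * n) ` sieved k"
    proof (cases "k dvd n")
      case True
      then obtain m where "n = k * m" by auto
      moreover from this have "m \<in> sieved k" using n by (auto simp: sieved_def)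
      ultimately show ?thesis by auto
    next
      case False
      thus ?thesis using n by (auto simp: sieved_def less_Suc_eq)
    qed
  next
    fix n assume n: "n \<in> sieved (Suc k) \<union> (\<lambda>n. k * n) ` sieved k"
    thus "n \<in> sieved k"
    proof
      assume "n \<in> (\<lambda>n. k * n) ` sieved k"
      then obtain m where m: "n = k * m" "m \<in> sieved k" by auto
      have "\<not> p dvd n" if "p < k" "Factorial_Ring.prime p" for p
      proof -
        have "\<not> p dvd k" using that assms primes_dvd_imp_eq by blast
        thus ?thesis using m that by (auto simp: sieved_def prime_dvd_mult_iff)
      qed
      thus ?thesis using m k0 by (auto simp: sieved_def)
    qed (auto simp: sieved_def)
  qed
  moreover have "sieved (Suc k) \<inter> (\<lambda>n. k * n) ` sieved k = {}"
    using assms by (auto simp: sieved_def)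
  ultimately have "infsum ?f (sieved k) = infsum ?f (sieved (Suc k)) + infsum ?f ((\<lambda>n. k * n) ` sieved k)"
    using infsum_Un_disjoint[OF powr_summable_on[OF assms(1)] powr_summable_on[OF assms(1)]] by metis
  also have "infsum ?f ((\<lambda>n. k * n) ` sieved k) = infsum (\<lambda>n. real k powr - s * real n powr - s) (sieved k)"
    using k0 by (subst infsum_reindex) (auto simp: inj_on_def o_def powr_mult)
  also have "\<dots> = real k powr - s * infsum ?f (sieved k)"
    by (intro infsum_cmult_right powr_summable_on assms)
  finally show ?thesis by (simp add: algebra_simps)
qed

text \<open>
  Euler's product formula.  Sieving by the primes below \<open>k\<close> divides \<open>\<zeta>(s)\<close> by the partial Euler
  product; what remains is the term of \<open>1\<close> plus terms beyond \<open>k - 1\<close>, hence tends to \<open>1\<close>.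
\<close>

lemma riemann_zeta_eq_zeta_of_primes:
  assumes "s > 1"
  shows "riemann_zeta s = zeta_of primes s"
proof -
  let ?f = "\<lambda>n. real n powr - s"
  let ?L = "\<lambda>p. if p \<in> primes then - ln (1 - real p powr (- s)) else 0"
  define T where "T = (\<lambda>k. infsum ?f (sieved k))"
  have partial: "exp (\<Sum>p<k. ?L p) * T k = riemann_zeta s" for k
  proof (induction k)
    case 0
    have "sieved 0 = {0<..}" by (auto simp: sieved_def)
    thus ?case using riemann_zeta_eq_infsum[OF assms] by (simp add: T_def)
  next
    case (Suc k)
    show ?case
    proof (cases "Factorial_Ring.prime k")
      case True
      define c where "c = 1 - real k powr - s"
      have c: "c > 0" using powr_neg_le_half[of k s] assms prime_ge_2_nat[OF True]
        by (auto simp: c_def)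
      have e: "exp (\<Sum>p<Suc k. ?L p) = exp (\<Sum>p<k. ?L p) / c"
        using True c by (simp add: exp_diff c_def [symmetric])
      have t: "T (Suc k) = T k * c"
        using sieve_step[OF assms True] by (simp add: T_def c_def)
      have "exp (\<Sum>p<Suc k. ?L p) * T (Suc k) = exp (\<Sum>p<k. ?L p) * T k"
        unfolding e t using c by simp
      thus ?thesis using Suc by simp
    next
      case False
      hence "sieved (Suc k) = sieved k" by (auto simp: sieved_def less_Suc_eq)
      thus ?thesis using False Suc by (simp add: T_def)
    qed
  qed
  have upper: "T (Suc k) \<le> 1 + riemann_zeta s - (\<Sum>n<Suc k. ?f n)" for k
  proof -
    \<comment> \<open>Every number from \<open>2\<close> to \<open>k\<close> has a prime factor at most \<open>k\<close> and is sieved out.\<close>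
    have d: "sieved (Suc k) \<subseteq> {0<..} - {2..k}"
    proof
      fix n assume n: "n \<in> sieved (Suc k)"
      have "n \<notin> {2..k}"
      proof
        assume nk: "n \<in> {2..k}"
        hence "n \<noteq> 1" by auto
        then obtain p where p: "Factorial_Ring.prime p" "p dvd n" using prime_factor_nat by blast
        moreover have "p \<le> n" using p nk by (auto intro: dvd_imp_le)
        ultimately show False using n nk by (auto simp: sieved_def)
      qed
      thus "n \<in> {0<..} - {2..k}" using n by (auto simp: sieved_def)
    qed
    hence "T (Suc k) \<le> infsum ?f ({0<..} - {2..k})"
      unfolding T_def by (intro infsum_mono2 powr_summable_on assms) auto
    also have "\<dots> = riemann_zeta s - infsum ?f {2..k}"
      unfolding riemann_zeta_eq_infsum[OF assms]
      by (intro infsum_Diff powr_summable_on assms) auto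
    also have "infsum ?f {2..k} = (\<Sum>n\<in>{2..k}. ?f n)" by simp
    also have "(\<Sum>n<Suc k. ?f n) \<le> 1 + (\<Sum>n\<in>{2..k}. ?f n)"
    proof -
      have "(\<Sum>n<Suc k. ?f n) \<le> (\<Sum>n\<in>{0,1} \<union> {2..k}. ?f n)"
        by (intro sum_mono2) auto
      also have "\<dots> = 1 + (\<Sum>n\<in>{2..k}. ?f n)" by (subst sum.union_disjoint) auto
      finally show ?thesis .
    qed
    hence "riemann_zeta s - (\<Sum>n\<in>{2..k}. ?f n) \<le> 1 + riemann_zeta s - (\<Sum>n<Suc k. ?f n)" by simp
    finally show ?thesis .
  qed
  have lower: "1 \<le> T k" for k
  proof -
    have "infsum ?f {1} \<le> T k" unfolding T_def
      by (intro infsum_mono2 powr_summable_on assms) (auto simp: sieved_def)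
    thus ?thesis by simp
  qed
  have sm: "summable (\<lambda>n. real n powr - s)" using assms by (simp add: summable_real_powr_iff)
  have "riemann_zeta s = suminf (\<lambda>n. ?f n)"
    using suminf_split_head[OF sm] by (simp add: riemann_zeta_def powr_minus divide_simps)
  hence "(\<lambda>k. \<Sum>n<k. ?f n) \<longlonglongrightarrow> riemann_zeta s" using summable_LIMSEQ[OF sm] by simp
  hence "(\<lambda>k. 1 + riemann_zeta s - (\<Sum>n<Suc k. ?f n)) \<longlonglongrightarrow> 1 + riemann_zeta s - riemann_zeta s"
    by (intro tendsto_diff tendsto_const LIMSEQ_Suc)
  hence lim: "(\<lambda>k. 1 + riemann_zeta s - (\<Sum>n<Suc k. ?f n)) \<longlonglongrightarrow> 1" by simp
  have T1: "(\<lambda>k. T (Suc k)) \<longlonglongrightarrow> 1"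
    by (rule tendsto_sandwich[OF _ _ tendsto_const lim])
       (auto simp del: sum.lessThan_Suc intro!: always_eventually lower upper)
  have "(\<lambda>k. exp (\<Sum>p<Suc k. ?L p) * T (Suc k)) \<longlonglongrightarrow> exp (suminf ?L) * 1"
    by (intro tendsto_mult T1 tendsto_exp LIMSEQ_Suc[OF summable_LIMSEQ] summable_euler_log
          primes_ge_2 assms)
  hence "exp (suminf ?L) * 1 = riemann_zeta s"
    using LIMSEQ_unique tendsto_const unfolding partial by blast
  thus ?thesis
    using zeta_of_eq_exp[OF primes_ge_2 assms] by (simp add: euler_log_def)
qed

lemma log_deriv_ratio_eq:
  assumes "A \<subseteq> primes" "s > 1"
  shows "log_deriv_ratio A s = prime_log_sum A s / prime_log_sum primes s"
proof -
  have "eventually (\<lambda>t. riemann_zeta t = zeta_of primes t) (nhds s)"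
    using eventually_nhds_in_open[of "{1<..}" s] assms
    by (auto elim!: eventually_mono simp: riemann_zeta_eq_zeta_of_primes)
  hence "deriv riemann_zeta s = deriv (zeta_of primes) s" by (intro deriv_cong_ev) auto
  hence "deriv riemann_zeta s / riemann_zeta s = - prime_log_sum primes s"
    using zeta_of_log_deriv[OF primes_ge_2 assms(2)] riemann_zeta_eq_zeta_of_primes[OF assms(2)]
    by simp
  moreover have "deriv (zeta_of A) s / zeta_of A s = - prime_log_sum A s"
    using assms primes_ge_2 by (intro zeta_of_log_deriv) auto
  ultimately show ?thesis by (simp add: log_deriv_ratio_def)
qed

lemma prime_log_sum_nonneg:
  assumes "A \<subseteq> {2..}" "s > 1"
  shows "prime_log_sum A s \<ge> 0"
  unfolding prime_log_sum_def
  using log_term_bounds(1) assms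
  by (intro suminf_nonneg summable_prime_log_sum) (auto simp: subset_iff)

lemma riemann_zeta_at_top: "filterlim riemann_zeta at_top (at_right 1)"
  unfolding filterlim_at_top
proof
  fix M :: real
  have "\<not> summable (\<lambda>n. real n powr - 1)" using summable_real_powr_iff[of "- 1"] by simp
  moreover have "summable (\<lambda>n. real n powr - 1)" if "\<And>k. (\<Sum>n<k. real n powr - 1) \<le> M + 1"
    using that by (intro summableI_nonneg_bounded[of _ "M + 1"]) auto
  ultimately obtain k where k: "(\<Sum>n<k. real n powr - 1) > M + 1" by (meson not_le)
  have "((\<lambda>s. \<Sum>n<k. real n powr - s) \<longlongrightarrow> (\<Sum>n<k. real n powr - 1)) (at_right 1)"
  proof (intro tendsto_sum)
    fix n :: nat
    show "((\<lambda>s. real n powr - s) \<longlongrightarrow> real n powr - 1) (at_right 1)"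
      by (cases "n = 0") (simp, intro tendsto_powr tendsto_const tendsto_minus tendsto_ident_at, simp)
  qed
  hence "eventually (\<lambda>s. (\<Sum>n<k. real n powr - s) > M + 1) (at_right 1)"
    using k by (rule order_tendstoD)
  moreover have "eventually (\<lambda>s::real. s > 1) (at_right 1)" by (simp add: eventually_at_right_less)
  ultimately show "eventually (\<lambda>s. M \<le> riemann_zeta s) (at_right 1)"
  proof eventually_elim
    case (elim s)
    have "(\<Sum>n<k. real n powr - s) = infsum (\<lambda>n. real n powr - s) {..<k}" by simp
    also have "\<dots> \<le> infsum (\<lambda>n. real n powr - s) {0<..}"
      using elim by (intro infsum_mono_neutral powr_summable_on) auto
    finally show ?case using elim riemann_zeta_eq_infsum[of s] by simp
  qed
qed

text \<open>
  Each term of \<open>ln \<zeta>(s) = - \<Sum> ln (1 - p\<^sup>-\<^sup>s)\<close> is at most \<open>2 p\<^sup>-\<^sup>s\<close>, which is at most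
  \<open>(2 / ln 2) ln p / (p\<^sup>s - 1)\<close>.  So the divergence of \<open>\<zeta>\<close> at \<open>1\<close> carries over.
\<close>

lemma prime_log_sum_primes_at_top: "filterlim (prime_log_sum primes) at_top (at_right 1)"
proof (rule filterlim_at_top_mono)
  show "filterlim (\<lambda>s. ln 2 / 2 * ln (riemann_zeta s)) at_top (at_right 1)"
    by (intro filterlim_tendsto_pos_mult_at_top[OF tendsto_const]
          filterlim_compose[OF ln_at_top riemann_zeta_at_top]) auto
  have "eventually (\<lambda>s::real. s > 1) (at_right 1)" by (simp add: eventually_at_right_less)
  thus "eventually (\<lambda>s. ln 2 / 2 * ln (riemann_zeta s) \<le> prime_log_sum primes s) (at_right 1)"
  proof eventually_elim
    case (elim s)
    have "ln (riemann_zeta s) = euler_log primes s"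
      using elim zeta_of_eq_exp[OF primes_ge_2 elim] riemann_zeta_eq_zeta_of_primes[OF elim] by simp
    moreover have "ln 2 / 2 * euler_log primes s \<le> prime_log_sum primes s"
      unfolding euler_log_def prime_log_sum_def
      apply (subst suminf_mult[OF summable_euler_log[OF primes_ge_2 elim], symmetric])
    proof (rule suminf_le)
      show "summable (\<lambda>n. ln 2 / 2 * (if n \<in> primes then - ln (1 - real n powr - s) else 0))"
        by (intro summable_mult summable_euler_log primes_ge_2 elim)
      show "summable (\<lambda>p. if p \<in> primes then ln (real p) / (real p powr s - 1) else 0)"
        by (intro summable_prime_log_sum primes_ge_2 elim)
      fix p
      show "ln 2 / 2 * (if p \<in> primes then - ln (1 - real p powr - s) else 0)
          \<le> (if p \<in> primes then ln (real p) / (real p powr s - 1) else 0)"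
      proof (cases "p \<in> primes")
        case True
        hence p: "p \<ge> 2" using primes_ge_2 by auto
        have "ln 2 / 2 * - ln (1 - real p powr - s) \<le> ln 2 / 2 * (2 * real p powr - s)"
          using euler_term_bounds[OF p, of s] elim by (intro mult_left_mono) auto
        also have "\<dots> = ln 2 * real p powr - s" by simp
        also have "\<dots> \<le> ln (real p) * real p powr - s"
          using p by (intro mult_right_mono) auto
        also have "\<dots> \<le> ln (real p) / (real p powr s - 1)"
          using log_term_bounds[OF p, of s] elim by auto
        finally show ?thesis using True by simp
      qed auto
    qed
    ultimately show ?case by simp
  qed
qed

text \<open>
  The ratio is \<open>1\<close> minus the contribution of the missing primes divided by that of all primes;
  the numerator stays bounded as \<open>s\<close> tends to \<open>1\<close> and the denominator does not.
\<close>

lemma log_deriv_ratio_tendsto_1: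
  assumes "A \<subseteq> primes" "summable (\<lambda>p. if p \<in> primes - A then ln (real p) / real p else 0)"
  shows "(log_deriv_ratio A \<longlongrightarrow> 1) (at_right 1)"
proof -
  let ?B = "primes - A"
  define c where "c = suminf (\<lambda>p. 2 * (if p \<in> ?B then ln (real p) / real p else 0))"
  have ev: "eventually (\<lambda>s::real. s > 1) (at_right 1)" by (simp add: eventually_at_right_less)
  have B2: "?B \<subseteq> {2..}" and A2: "A \<subseteq> {2..}" using primes_ge_2 assms by auto
  have bnd: "prime_log_sum ?B s \<le> c" if s: "s > 1" for s
    unfolding prime_log_sum_def c_def
  proof (intro suminf_le summable_mult assms(2) summable_prime_log_sum B2 s)
    fix p
    show "(if p \<in> ?B then ln (real p) / (real p powr s - 1) else 0)
          \<le> 2 * (if p \<in> ?B then ln (real p) / real p else 0)"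
    proof (cases "p \<in> ?B")
      case True
      hence p: "p \<ge> 2" using B2 by auto
      have "ln (real p) / (real p powr s - 1) \<le> 2 * (ln (real p) * real p powr - s)"
        using log_term_bounds[OF p, of s] s by auto
      also have "\<dots> \<le> 2 * (ln (real p) * real p powr - 1)"
        using p s by (intro mult_left_mono powr_mono) auto
      finally show ?thesis using True p by (simp add: powr_minus field_simps)
    qed auto
  qed
  have "((\<lambda>s. prime_log_sum ?B s / prime_log_sum primes s) \<longlongrightarrow> 0) (at_right 1)"
  proof (rule tendsto_sandwich[where f = "\<lambda>_. 0" and h = "\<lambda>s. c / prime_log_sum primes s"])
    show "((\<lambda>s. c / prime_log_sum primes s) \<longlongrightarrow> 0) (at_right 1)"
      by (rule tendsto_divide_0[OF tendsto_const filterlim_at_top_imp_at_infinity[OF prime_log_sum_primes_at_top]])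
    show "eventually (\<lambda>s. 0 \<le> prime_log_sum ?B s / prime_log_sum primes s) (at_right 1)"
      using ev by eventually_elim (intro divide_nonneg_nonneg prime_log_sum_nonneg B2 primes_ge_2)
    show "eventually (\<lambda>s. prime_log_sum ?B s / prime_log_sum primes s
            \<le> c / prime_log_sum primes s) (at_right 1)"
      using ev by eventually_elim (intro divide_right_mono prime_log_sum_nonneg bnd primes_ge_2)
  qed auto
  hence "((\<lambda>s. 1 - prime_log_sum ?B s / prime_log_sum primes s) \<longlongrightarrow> 1 - 0) (at_right 1)"
    by (intro tendsto_intros)
  moreover have "eventually (\<lambda>s. 1 - prime_log_sum ?B s / prime_log_sum primes s = log_deriv_ratio A s) (at_right 1)"
    using ev filterlim_at_top_dense[THEN iffD1, OF prime_log_sum_primes_at_top, rule_format, of 0]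
  proof eventually_elim
    case (elim s)
    have "prime_log_sum primes s = prime_log_sum A s + prime_log_sum ?B s"
      unfolding prime_log_sum_def
      using assms(1)
      by (subst suminf_add[OF summable_prime_log_sum[OF A2 elim(1)] summable_prime_log_sum[OF B2 elim(1)]])
         (auto intro!: suminf_cong)
    thus ?case using elim assms(1) by (simp add: log_deriv_ratio_eq field_simps)
  qed
  ultimately show ?thesis using Lim_transform_eventually by fastforce
qed

lemma lower_density_nonneg:
  assumes "A \<subseteq> primes"
  shows "lower_density A \<ge> 0"
  unfolding lower_density_def
proof (rule Liminf_bounded)
  have "eventually (\<lambda>s::real. s > 1) (at_right 1)" by (simp add: eventually_at_right_less)
  thus "eventually (\<lambda>s. 0 \<le> ereal (log_deriv_ratio A s)) (at_right 1)"
  proof eventually_elim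
    case (elim s)
    have "A \<subseteq> {2..}" using assms primes_ge_2 by blast
    thus ?case using assms elim prime_log_sum_nonneg primes_ge_2
      by (simp add: log_deriv_ratio_eq)
  qed
qed

section \<open>Iterating a map on projective classes\<close>

text \<open>
  Used over the rationals in contrapositive form: an infinite orbit has pairwise distinct iterates.
\<close>

lemma finite_forward_orbit_if_repeats:
  assumes "i < j" "(f ^^ i) x = (f ^^ j) x"
  shows "finite (forward_orbit f x)"
proof -
  have "(f ^^ n) x \<in> (\<lambda>k. (f ^^ k) x) ` {..<j}" for n
  proof (induction n rule: less_induct)
    case (less n)
    show ?case
    proof (cases "n < j")
      case False
      hence "(f ^^ n) x = (f ^^ (n - j)) ((f ^^ j) x)"
        using funpow_add[of "n - j" j f] by simp
      also have "\<dots> = (f ^^ (n - j + i)) x" by (simp add: assms(2) funpow_add)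
      finally show ?thesis using less.IH[of "n - j + i"] False assms(1) by simp
    qed auto
  qed
  hence "forward_orbit f x \<subseteq> (\<lambda>k. (f ^^ k) x) ` {..<j}" by (auto simp: forward_orbit_def)
  thus ?thesis by (rule finite_subset) auto
qed

lemma card_forward_orbit_ge:
  assumes "finite (forward_orbit f x)" "inj_on (\<lambda>n. (f ^^ n) x) {..M}"
  shows "card (forward_orbit f x) \<ge> Suc M"
proof -
  have "card ((\<lambda>n. (f ^^ n) x) ` {..M}) \<le> card (forward_orbit f x)"
    using assms(1) by (intro card_mono) (auto simp: forward_orbit_def)
  thus ?thesis using card_image[OF assms(2)] by simp
qed

lemma proj_rel_equiv:
  assumes "field K"
  shows "equiv (proj_coords N K) (proj_rel N K)"
proof -
  interpret field K by fact
  have "refl_on (proj_coords N K) (proj_rel N K)"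
    unfolding refl_on_def proj_rel_def proj_coords_def
    by (auto intro!: bexI[of _ "\<one>\<^bsub>K\<^esub>"] simp: PiE_iff)
  moreover have "sym (proj_rel N K)"
  proof (rule symI)
    fix x y assume "(x, y) \<in> proj_rel N K"
    then obtain c where c: "x \<in> proj_coords N K" "y \<in> proj_coords N K"
        "c \<in> carrier K - {\<zero>\<^bsub>K\<^esub>}" "\<forall>i\<le>N. y i = c \<otimes>\<^bsub>K\<^esub> x i"
      by (auto simp: proj_rel_def)
    hence u: "c \<in> Units K" by (simp add: field_Units)
    have "x i = inv\<^bsub>K\<^esub> c \<otimes>\<^bsub>K\<^esub> y i" if "i \<le> N" for i
    proof -
      have "x i \<in> carrier K" using c that by (auto simp: proj_coords_def PiE_iff)
      thus ?thesis using c that u by (simp add: m_assoc [symmetric] Units_l_inv)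
    qed
    moreover have "inv\<^bsub>K\<^esub> c \<in> carrier K - {\<zero>\<^bsub>K\<^esub>}"
      using Units_inv_Units[OF u] by (simp add: field_Units)
    ultimately show "(y, x) \<in> proj_rel N K" using c by (auto simp: proj_rel_def)
  qed
  moreover have "trans (proj_rel N K)"
  proof (rule transI)
    fix x y z assume "(x, y) \<in> proj_rel N K" "(y, z) \<in> proj_rel N K"
    then obtain c c' where c: "x \<in> proj_coords N K" "z \<in> proj_coords N K"
        "c \<in> carrier K - {\<zero>\<^bsub>K\<^esub>}" "\<forall>i\<le>N. y i = c \<otimes>\<^bsub>K\<^esub> x i"
        "c' \<in> carrier K - {\<zero>\<^bsub>K\<^esub>}" "\<forall>i\<le>N. z i = c' \<otimes>\<^bsub>K\<^esub> y i"
      unfolding proj_rel_def by blast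
    have "z i = (c' \<otimes>\<^bsub>K\<^esub> c) \<otimes>\<^bsub>K\<^esub> x i" if "i \<le> N" for i
    proof -
      have "x i \<in> carrier K" using c that by (auto simp: proj_coords_def PiE_iff)
      thus ?thesis using c that by (simp add: m_assoc)
    qed
    moreover have "c' \<otimes>\<^bsub>K\<^esub> c \<in> carrier K - {\<zero>\<^bsub>K\<^esub>}" using c by (auto simp: integral_iff)
    ultimately show "(x, z) \<in> proj_rel N K" using c by (auto simp: proj_rel_def)
  qed
  moreover have "proj_rel N K \<subseteq> proj_coords N K \<times> proj_coords N K"
    by (auto simp: proj_rel_def)
  ultimately show ?thesis by (simp add: equiv_def)
qed

lemma (in comm_monoid) finprod_pow_const:
  assumes "finite A" "c \<in> carrier G"
  shows "(\<Otimes>i\<in>A. c [^] (e i :: nat)) = c [^] (\<Sum>i\<in>A. e i)"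
  using assms by (induction A rule: finite_induct) (auto simp: nat_pow_mult)

lemma mpoly_eval_closed:
  assumes "cring K" "\<forall>m\<in>Poly_Mapping.keys f. Poly_Mapping.keys m \<subseteq> {..N}"
    and "\<forall>m\<in>Poly_Mapping.keys f. h (Poly_Mapping.lookup f m) \<in> carrier K"
    and "\<forall>i\<le>N. x i \<in> carrier K"
  shows "mpoly_eval K h f x \<in> carrier K"
proof -
  interpret cring K by fact
  show ?thesis unfolding mpoly_eval_def
    using assms by (intro finsum_closed Pi_I m_closed finprod_closed nat_pow_closed) auto
qed

text \<open>
  Euler's scaling law \<open>f(c x) = c\<^sup>d f(x)\<close>, which makes the image of a projective class a class.
\<close>

lemma mpoly_eval_scale:
  assumes "cring K" "homogeneous_mpoly N d f"
    and h: "\<forall>m\<in>Poly_Mapping.keys f. h (Poly_Mapping.lookup f m) \<in> carrier K"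
    and x: "\<forall>i\<le>N. x i \<in> carrier K" and c: "c \<in> carrier K"
    and y: "\<forall>i\<le>N. y i = c \<otimes>\<^bsub>K\<^esub> x i"
  shows "mpoly_eval K h f y = c [^]\<^bsub>K\<^esub> d \<otimes>\<^bsub>K\<^esub> mpoly_eval K h f x"
proof -
  interpret cring K by fact
  let ?mon = "\<lambda>m. \<Otimes>\<^bsub>K\<^esub>i\<in>Poly_Mapping.keys m. x i [^]\<^bsub>K\<^esub> Poly_Mapping.lookup m i"
  have mon: "(\<Otimes>\<^bsub>K\<^esub>i\<in>Poly_Mapping.keys m. y i [^]\<^bsub>K\<^esub> Poly_Mapping.lookup m i)
      = c [^]\<^bsub>K\<^esub> d \<otimes>\<^bsub>K\<^esub> ?mon m" and mon_c: "?mon m \<in> carrier K"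
    if "m \<in> Poly_Mapping.keys f" for m
  proof -
    have k: "Poly_Mapping.keys m \<subseteq> {..N}"
        and deg: "(\<Sum>i\<in>Poly_Mapping.keys m. Poly_Mapping.lookup m i) = d"
      using that assms(2) by (auto simp: homogeneous_mpoly_def)
    have xk: "x i \<in> carrier K" if "i \<in> Poly_Mapping.keys m" for i
      using k that x by auto
    thus "?mon m \<in> carrier K" by (intro finprod_closed) auto
    have "(\<Otimes>\<^bsub>K\<^esub>i\<in>Poly_Mapping.keys m. y i [^]\<^bsub>K\<^esub> Poly_Mapping.lookup m i)
        = (\<Otimes>\<^bsub>K\<^esub>i\<in>Poly_Mapping.keys m. c [^]\<^bsub>K\<^esub> Poly_Mapping.lookup m i
            \<otimes>\<^bsub>K\<^esub> x i [^]\<^bsub>K\<^esub> Poly_Mapping.lookup m i)"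
      using k xk y c by (intro finprod_cong') (auto simp: nat_pow_distrib)
    also have "\<dots> = (\<Otimes>\<^bsub>K\<^esub>i\<in>Poly_Mapping.keys m. c [^]\<^bsub>K\<^esub> Poly_Mapping.lookup m i) \<otimes>\<^bsub>K\<^esub> ?mon m"
      using xk c by (intro finprod_multf) auto
    also have "\<dots> = c [^]\<^bsub>K\<^esub> d \<otimes>\<^bsub>K\<^esub> ?mon m"
      using c deg by (simp add: finprod_pow_const)
    finally show "(\<Otimes>\<^bsub>K\<^esub>i\<in>Poly_Mapping.keys m. y i [^]\<^bsub>K\<^esub> Poly_Mapping.lookup m i)
      = c [^]\<^bsub>K\<^esub> d \<otimes>\<^bsub>K\<^esub> ?mon m" .
  qed
  have "mpoly_eval K h f y = (\<Oplus>\<^bsub>K\<^esub>m\<in>Poly_Mapping.keys f. c [^]\<^bsub>K\<^esub> d \<otimes>\<^bsub>K\<^esub>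
      (h (Poly_Mapping.lookup f m) \<otimes>\<^bsub>K\<^esub> ?mon m))"
    unfolding mpoly_eval_def
    using h c mon_c by (intro finsum_cong') (simp_all add: mon m_lcomm)
  also have "\<dots> = c [^]\<^bsub>K\<^esub> d \<otimes>\<^bsub>K\<^esub> mpoly_eval K h f x"
    unfolding mpoly_eval_def using h c mon_c by (intro finsum_rdistr [symmetric]) auto
  finally show ?thesis .
qed

lemma proj_coords_carrier: "x \<in> proj_coords N K \<Longrightarrow> i \<le> N \<Longrightarrow> x i \<in> carrier K"
  by (auto simp: proj_coords_def)

lemma homogeneous_mpoly_keys:
  "homogeneous_mpoly N d f \<Longrightarrow> \<forall>m\<in>Poly_Mapping.keys f. Poly_Mapping.keys m \<subseteq> {..N}"
  by (simp add: homogeneous_mpoly_def)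

text \<open>
  If all forms vanish at \<open>x\<close>, both sides are empty, because the zero vector is not related to
  anything.  This convention lets the equation hold at every point, common zeros included.
\<close>

lemma proj_map_class:
  fixes K :: "'a::zero ring"
  assumes K: "field K" and x: "x \<in> proj_coords N K"
    and F: "\<forall>i\<le>N. homogeneous_mpoly N d (F i)"
    and c: "\<forall>i\<le>N. \<forall>m\<in>Poly_Mapping.keys (F i). Poly_Mapping.lookup (F i) m \<in> carrier K"
  shows "proj_map N K F (proj_rel N K `` {x}) =
           proj_rel N K `` {\<lambda>i\<in>{..N}. mpoly_eval K id (F i) x}"
proof -
  interpret field K by fact
  define E where "E = (\<lambda>x. \<lambda>i\<in>{..N}. mpoly_eval K id (F i) x)"
  have carr: "mpoly_eval K id (F i) x' \<in> carrier K" if "x' \<in> proj_coords N K" "i \<le> N" for x' i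
  proof (rule mpoly_eval_closed[where N = N])
    show "\<forall>m\<in>Poly_Mapping.keys (F i). Poly_Mapping.keys m \<subseteq> {..N}"
      using homogeneous_mpoly_keys F that by blast
    show "\<forall>m\<in>Poly_Mapping.keys (F i). id (Poly_Mapping.lookup (F i) m) \<in> carrier K"
      using c that by simp
    show "\<forall>i\<le>N. x' i \<in> carrier K" using proj_coords_carrier[OF that(1)] by blast
  qed (rule is_cring)
  have cl: "E x' i \<in> carrier K" if "x' \<in> proj_coords N K" "i \<le> N" for x' i
    using carr[OF that] that by (simp add: E_def)
  have coords: "E x' \<in> proj_coords N K \<longleftrightarrow> (\<exists>i\<le>N. E x' i \<noteq> \<zero>\<^bsub>K\<^esub>)" if "x' \<in> proj_coords N K" for x'
  proof -
    have "E x' \<in> {..N} \<rightarrow>\<^sub>E carrier K"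
      using carr[OF that] by (simp add: E_def)
    thus ?thesis unfolding proj_coords_def by blast
  qed
  have eq: "proj_rel N K `` {E x'} = proj_rel N K `` {E x}" if "(x, x') \<in> proj_rel N K" for x'
  proof -
    from that obtain t where x': "x' \<in> proj_coords N K"
      and t: "t \<in> carrier K - {\<zero>\<^bsub>K\<^esub>}" "\<forall>i\<le>N. x' i = t \<otimes>\<^bsub>K\<^esub> x i"
      unfolding proj_rel_def by blast
    have td: "t [^]\<^bsub>K\<^esub> d \<in> carrier K - {\<zero>\<^bsub>K\<^esub>}"
    proof -
      have "t \<in> Units K" using t by (simp add: field_Units)
      hence "t [^]\<^bsub>K\<^esub> d \<in> Units K" by (rule Units_pow_closed)
      thus ?thesis by (simp only: field_Units)
    qed
    have E: "E x' i = t [^]\<^bsub>K\<^esub> d \<otimes>\<^bsub>K\<^esub> E x i" if "i \<le> N" for i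
    proof -
      have "mpoly_eval K id (F i) x' = t [^]\<^bsub>K\<^esub> d \<otimes>\<^bsub>K\<^esub> mpoly_eval K id (F i) x"
      proof (rule mpoly_eval_scale[where N = N])
        show "homogeneous_mpoly N d (F i)" using F that by blast
        show "\<forall>m\<in>Poly_Mapping.keys (F i). id (Poly_Mapping.lookup (F i) m) \<in> carrier K"
          using c that by simp
        show "\<forall>i\<le>N. x i \<in> carrier K" using proj_coords_carrier[OF x] by blast
        show "t \<in> carrier K" using t by simp
        show "\<forall>i\<le>N. x' i = t \<otimes>\<^bsub>K\<^esub> x i" using t by blast
      qed (rule is_cring)
      thus ?thesis using that by (simp add: E_def)
    qed
    have nz: "E x' i \<noteq> \<zero>\<^bsub>K\<^esub> \<longleftrightarrow> E x i \<noteq> \<zero>\<^bsub>K\<^esub>" if "i \<le> N" for i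
    proof -
      have "t [^]\<^bsub>K\<^esub> d \<otimes>\<^bsub>K\<^esub> E x i = \<zero>\<^bsub>K\<^esub> \<longleftrightarrow> E x i = \<zero>\<^bsub>K\<^esub>"
        using td cl[OF x that] by (subst integral_iff) auto
      thus ?thesis by (simp only: E[OF that])
    qed
    show ?thesis
    proof (cases "E x \<in> proj_coords N K")
      case True
      hence "E x' \<in> proj_coords N K"
        using nz coords x x' by blast
      hence "(E x, E x') \<in> proj_rel N K"
        unfolding proj_rel_def using True td E by blast
      thus ?thesis by (rule equiv_class_eq[OF proj_rel_equiv[OF K], symmetric])
    next
      case False
      hence "E x' \<notin> proj_coords N K"
        using nz coords x x' by blast
      with False show ?thesis unfolding proj_rel_def by blast
    qed
  qed
  have "x \<in> proj_rel N K `` {x}"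
    by (rule equiv_class_self[OF proj_rel_equiv[OF K] x])
  moreover have "(\<Union>x'\<in>proj_rel N K `` {x}. proj_rel N K `` {E x'})
      = (\<Union>x'\<in>proj_rel N K `` {x}. proj_rel N K `` {E x})"
  proof (rule SUP_cong[OF refl])
    fix x' assume "x' \<in> proj_rel N K `` {x}"
    thus "proj_rel N K `` {E x'} = proj_rel N K `` {E x}" by (intro eq) simp
  qed
  ultimately have "(\<Union>x'\<in>proj_rel N K `` {x}. proj_rel N K `` {E x'}) = proj_rel N K `` {E x}"
    by blast
  moreover have "proj_rel N K `` (E ` B) = (\<Union>x'\<in>B. proj_rel N K `` {E x'})" for B
    by blast
  moreover have "proj_map N K F (proj_rel N K `` {x}) = proj_rel N K `` (E ` (proj_rel N K `` {x}))"
    by (simp only: proj_map_def E_def)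
  ultimately show ?thesis by (simp only: E_def)
qed

text \<open>
  Any sequence of coordinate vectors that follows the map up to nonzero scalars computes the
  iterates.  The scalars leave room for integer coordinates over the rationals.
\<close>

lemma proj_map_iterate_class:
  fixes K :: "'a::zero ring"
  assumes K: "field K"
    and F: "\<forall>i\<le>N. homogeneous_mpoly N d (F i)"
    and c: "\<forall>i\<le>N. \<forall>m\<in>Poly_Mapping.keys (F i). Poly_Mapping.lookup (F i) m \<in> carrier K"
    and v: "\<forall>n\<le>M. v n \<in> proj_coords N K"
    and step: "\<forall>n<M. (\<lambda>i\<in>{..N}. mpoly_eval K id (F i) (v n), v (Suc n)) \<in> proj_rel N K"
    and n: "n \<le> M"
  shows "(proj_map N K F ^^ n) (proj_rel N K `` {v 0}) = proj_rel N K `` {v n}"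
  using n
proof (induction n)
  case (Suc n)
  have "(proj_map N K F ^^ Suc n) (proj_rel N K `` {v 0}) = proj_map N K F (proj_rel N K `` {v n})"
    using Suc by simp
  also have "\<dots> = proj_rel N K `` {\<lambda>i\<in>{..N}. mpoly_eval K id (F i) (v n)}"
    using Suc.prems v by (intro proj_map_class[OF K _ F c]) auto
  also have "\<dots> = proj_rel N K `` {v (Suc n)}"
    using Suc.prems step by (intro equiv_class_eq[OF proj_rel_equiv[OF K]]) auto
  finally show ?case .
qed auto

section \<open>Integer forms over the rationals and modulo a prime\<close>

definition int_eval :: "int mpoly \<Rightarrow> (nat \<Rightarrow> int) \<Rightarrow> int" where
  "int_eval f a = (\<Sum>m\<in>Poly_Mapping.keys f. Poly_Mapping.lookup f m *
     (\<Prod>i\<in>Poly_Mapping.keys m. a i ^ Poly_Mapping.lookup m i))"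

lemma lookup_map:
  "Poly_Mapping.lookup (Poly_Mapping.map h f) m =
     (if Poly_Mapping.lookup f m = 0 then 0 else h (Poly_Mapping.lookup f m))"
  by (simp add: Poly_Mapping.map.rep_eq when_def)

lemma rat_field: "field rat_field"
  by (rule field_from_type_algebra)

lemma rat_field_simps:
  "carrier rat_field = UNIV" "\<zero>\<^bsub>rat_field\<^esub> = 0" "\<one>\<^bsub>rat_field\<^esub> = 1"
  "x \<otimes>\<^bsub>rat_field\<^esub> y = x * y" "x \<oplus>\<^bsub>rat_field\<^esub> y = x + y"
  by (simp_all add: ring_of_type_algebra_def)

lemma rat_field_nat_pow: "x [^]\<^bsub>rat_field\<^esub> (n::nat) = x ^ n"
proof -
  interpret field rat_field by (rule rat_field)
  show ?thesis by (induction n) (simp_all add: rat_field_simps mult.commute)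
qed

lemma rat_field_finsum:
  assumes "finite A" shows "finsum rat_field f A = sum f A"
proof -
  interpret field rat_field by (rule rat_field)
  show ?thesis using assms
    by (induction A rule: finite_induct) (simp_all add: rat_field_simps)
qed

lemma rat_field_finprod:
  assumes "finite A" shows "finprod rat_field f A = prod f A"
proof -
  interpret field rat_field by (rule rat_field)
  show ?thesis using assms
    by (induction A rule: finite_induct) (simp_all add: rat_field_simps)
qed

text \<open>
  Over the rationals, a form that is \<open>c\<close> times an integer form takes \<open>c\<close> times the integer value.
\<close>

lemma rat_mpoly_eval:
  assumes F: "f = Poly_Mapping.map (\<lambda>a. c * of_int a) g" and "c \<noteq> 0"
    and k: "homogeneous_mpoly N d f"
    and x: "\<forall>i\<le>N. x i = of_int (a i)"
  shows "mpoly_eval rat_field id f x = c * of_int (int_eval g a)"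
proof -
  have keys: "Poly_Mapping.keys f = Poly_Mapping.keys g"
    using assms(2) by (auto simp: F in_keys_iff lookup_map)
  have "mpoly_eval rat_field id f x = (\<Sum>m\<in>Poly_Mapping.keys f. Poly_Mapping.lookup f m *
     (\<Prod>i\<in>Poly_Mapping.keys m. x i ^ Poly_Mapping.lookup m i))"
    by (simp add: mpoly_eval_def rat_field_finsum rat_field_finprod rat_field_simps rat_field_nat_pow)
  also have "\<dots> = (\<Sum>m\<in>Poly_Mapping.keys g. c * of_int (Poly_Mapping.lookup g m *
     (\<Prod>i\<in>Poly_Mapping.keys m. a i ^ Poly_Mapping.lookup m i)))"
  proof (rule sum.cong)
    fix m assume m: "m \<in> Poly_Mapping.keys g"
    have "i \<in> Poly_Mapping.keys m \<Longrightarrow> i \<le> N" for i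
      using homogeneous_mpoly_keys[OF k] m keys by blast
    hence "(\<Prod>i\<in>Poly_Mapping.keys m. x i ^ Poly_Mapping.lookup m i) =
        (\<Prod>i\<in>Poly_Mapping.keys m. of_int (a i) ^ Poly_Mapping.lookup m i)"
      using x by (intro prod.cong) auto
    moreover have "Poly_Mapping.lookup f m = c * of_int (Poly_Mapping.lookup g m)"
      using m by (simp add: F lookup_map in_keys_iff)
    ultimately show "Poly_Mapping.lookup f m * (\<Prod>i\<in>Poly_Mapping.keys m. x i ^ Poly_Mapping.lookup m i)
      = c * of_int (Poly_Mapping.lookup g m *
         (\<Prod>i\<in>Poly_Mapping.keys m. a i ^ Poly_Mapping.lookup m i))"
      by simp
  qed (fact keys)
  finally show ?thesis by (simp add: int_eval_def sum_distrib_left)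
qed

lemma prime_field_residues: "Factorial_Ring.prime p \<Longrightarrow> residues (int p)"
  using prime_gt_1_nat[of p] by (simp add: residues_def)

lemma prime_field_field:
  assumes "Factorial_Ring.prime p" shows "field (prime_field p)"
proof -
  interpret residues_prime p "prime_field p"
    by unfold_locales (simp_all add: assms prime_gt_1_nat)
  show ?thesis by (rule is_field)
qed

lemma prime_field_simps:
  "carrier (prime_field p) = {0..<int p}" "\<zero>\<^bsub>prime_field p\<^esub> = 0"
  "x \<otimes>\<^bsub>prime_field p\<^esub> y = (x * y) mod int p"
  by (auto simp: residue_ring_def)

text \<open>
  Evaluation commutes with reduction.  Monomials whose coefficient is divisible by \<open>p\<close> disappear
  from the reduced polynomial, and their contribution to the integer value is divisible by \<open>p\<close>.
\<close>

lemma prime_field_mpoly_eval: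
  assumes p: "Factorial_Ring.prime p"
    and k: "\<forall>m\<in>Poly_Mapping.keys g. Poly_Mapping.keys m \<subseteq> {..N}"
    and x: "\<forall>i\<le>N. x i = a i mod int p"
  shows "mpoly_eval (prime_field p) id (Poly_Mapping.map (\<lambda>z. z mod int p) g) x = int_eval g a mod int p"
proof -
  interpret residues "int p" "prime_field p" by (rule prime_field_residues[OF p]) simp
  define g' where "g' = Poly_Mapping.map (\<lambda>z. z mod int p) g"
  have lk: "Poly_Mapping.lookup g' m = Poly_Mapping.lookup g m mod int p" for m
    by (simp add: g'_def lookup_map)
  have sub: "Poly_Mapping.keys g' \<subseteq> Poly_Mapping.keys g"
    by (auto simp: in_keys_iff lk)
  define mon where "mon = (\<lambda>m. \<Prod>i\<in>Poly_Mapping.keys m. a i ^ Poly_Mapping.lookup m i)"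
  have monR: "(\<Otimes>\<^bsub>prime_field p\<^esub>i\<in>Poly_Mapping.keys m. x i [^]\<^bsub>prime_field p\<^esub> Poly_Mapping.lookup m i)
      = mon m mod int p" if "m \<in> Poly_Mapping.keys g" for m
  proof -
    have "(\<Otimes>\<^bsub>prime_field p\<^esub>i\<in>Poly_Mapping.keys m. x i [^]\<^bsub>prime_field p\<^esub> Poly_Mapping.lookup m i)
        = (\<Otimes>\<^bsub>prime_field p\<^esub>i\<in>Poly_Mapping.keys m. (a i ^ Poly_Mapping.lookup m i) mod int p)"
    proof (rule finprod_cong'[OF refl])
      show "(\<lambda>i. a i ^ Poly_Mapping.lookup m i mod int p) \<in> Poly_Mapping.keys m \<rightarrow> carrier (prime_field p)"
        by blast
      fix i assume "i \<in> Poly_Mapping.keys m"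
      hence "i \<le> N" using k that by blast
      thus "x i [^]\<^bsub>prime_field p\<^esub> Poly_Mapping.lookup m i = a i ^ Poly_Mapping.lookup m i mod int p"
        using x pow_cong by simp
    qed
    also have "\<dots> = mon m mod int p" unfolding mon_def by (rule prod_cong) simp
    finally show ?thesis .
  qed
  have "mpoly_eval (prime_field p) id g' x
      = (\<Oplus>\<^bsub>prime_field p\<^esub>m\<in>Poly_Mapping.keys g'. (Poly_Mapping.lookup g m * mon m) mod int p)"
    unfolding mpoly_eval_def
  proof (rule finsum_cong'[OF refl])
    show "(\<lambda>m. Poly_Mapping.lookup g m * mon m mod int p) \<in> Poly_Mapping.keys g' \<rightarrow> carrier (prime_field p)"
      by blast
    fix m assume "m \<in> Poly_Mapping.keys g'"
    hence m: "m \<in> Poly_Mapping.keys g" using sub by blast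
    show "id (Poly_Mapping.lookup g' m) \<otimes>\<^bsub>prime_field p\<^esub>
        (\<Otimes>\<^bsub>prime_field p\<^esub>i\<in>Poly_Mapping.keys m. x i [^]\<^bsub>prime_field p\<^esub> Poly_Mapping.lookup m i)
        = Poly_Mapping.lookup g m * mon m mod int p"
      unfolding monR[OF m] lk id_apply by (rule mult_cong)
  qed
  also have "\<dots> = (\<Sum>m\<in>Poly_Mapping.keys g'. Poly_Mapping.lookup g m * mon m) mod int p"
    by (rule sum_cong) simp
  also have "\<dots> = (\<Sum>m\<in>Poly_Mapping.keys g. Poly_Mapping.lookup g m * mon m) mod int p"
  proof -
    have "int p dvd (\<Sum>m\<in>Poly_Mapping.keys g - Poly_Mapping.keys g'. Poly_Mapping.lookup g m * mon m)"
      by (intro dvd_sum dvd_mult2) (simp add: in_keys_iff lk dvd_eq_mod_eq_0)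
    moreover have "(\<Sum>m\<in>Poly_Mapping.keys g. Poly_Mapping.lookup g m * mon m) =
        (\<Sum>m\<in>Poly_Mapping.keys g - Poly_Mapping.keys g'. Poly_Mapping.lookup g m * mon m) +
        (\<Sum>m\<in>Poly_Mapping.keys g'. Poly_Mapping.lookup g m * mon m)"
      using sub by (intro sum.subset_diff) auto
    ultimately show ?thesis by (auto elim!: dvdE)
  qed
  finally show ?thesis by (simp add: g'_def int_eval_def mon_def)
qed

section \<open>Coprime integer models and reduction\<close>

text \<open>
  Clear denominators, then divide by the greatest common divisor.  This serves both for the
  coefficients of the map and for the coordinates of the point.
\<close>

lemma rats_eq_scaled_coprime_ints:
  fixes A :: "rat set"
  assumes "finite A" "\<exists>x\<in>A. x \<noteq> 0"
  obtains c :: rat and z :: "rat \<Rightarrow> int" where "c \<noteq> 0" "\<And>x. x \<in> A \<Longrightarrow> x = c * of_int (z x)" "Gcd (z ` A) = 1"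
proof -
  have "\<exists>D::int. D > 0 \<and> (\<forall>x\<in>A. x * of_int D \<in> \<int>)" using assms(1)
  proof (induction A rule: finite_induct)
    case (insert q A)
    then obtain D :: int where D: "D > 0" "\<forall>x\<in>A. x * of_int D \<in> \<int>" by blast
    obtain a b where q: "q = of_int a / of_int b" "b > 0"
      by (metis Rat_cases_nonzero quotient_of_div quotient_of_denom_pos surj_pair)
    have "x * of_int (D * b) \<in> \<int>" if "x \<in> insert q A" for x
    proof (cases "x = q")
      case True
      hence "x * of_int (D * b) = of_int (a * D)" using q by simp
      thus ?thesis by (simp only: Ints_of_int)
    next
      case False
      hence "x * of_int D \<in> \<int>" using that D by blast
      hence "x * of_int D * of_int b \<in> \<int>" by (rule Ints_mult[OF _ Ints_of_int])
      thus ?thesis by (simp only: of_int_mult mult.assoc)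
    qed
    thus ?case using D(1) q(2) by (intro exI[of _ "D * b"]) auto
  qed (auto intro!: exI[of _ 1])
  then obtain D :: int where D: "D > 0" "\<forall>x\<in>A. x * of_int D \<in> \<int>" by blast
  define w where "w = (\<lambda>x::rat. \<lfloor>x * of_int D\<rfloor>)"
  have w: "of_int (w x) = x * of_int D" if "x \<in> A" for x
    using D that by (simp add: w_def)
  define g where "g = Gcd (w ` A)"
  obtain x0 where x0: "x0 \<in> A" "x0 \<noteq> 0" using assms by blast
  have "w x0 \<noteq> 0" using w[OF x0(1)] x0 D by auto
  hence "g \<noteq> 0" using x0 by (auto simp: g_def Gcd_0_iff)
  define z where "z = (\<lambda>x. w x div g)"
  have gz: "w x = g * z x" if "x \<in> A" for x
  proof -
    have "g dvd w x" unfolding g_def using that by (intro Gcd_dvd) auto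
    thus ?thesis by (simp add: z_def)
  qed
  show ?thesis
  proof (rule that[of "of_int g / of_int D" z])
    show "of_int g / of_int D \<noteq> (0::rat)" using \<open>g \<noteq> 0\<close> D by simp
    show "x = of_int g / of_int D * of_int (z x)" if "x \<in> A" for x
    proof -
      have "of_int g * of_int (z x) = x * of_int D"
        using w[OF that] gz[OF that] by simp
      thus ?thesis using D by (simp add: field_simps)
    qed
    have "w ` A = (*) g ` (z ` A)" using gz by (force simp: image_image)
    hence "g = normalize (g * Gcd (z ` A))" unfolding g_def by (metis Gcd_mult)
    moreover have "g \<ge> 0" by (simp add: g_def)
    moreover have "Gcd (z ` A) \<ge> 0" by simp
    ultimately show "Gcd (z ` A) = 1" using \<open>g \<noteq> 0\<close> by (simp add: abs_mult)
  qed
qed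

lemma exists_primitive_model:
  assumes "\<exists>i\<le>N. F i \<noteq> 0"
  shows "\<exists>G. primitive_model N F G"
proof -
  define A where "A = (\<Union>i\<le>N. Poly_Mapping.range (F i))"
  have fin: "finite A" by (simp add: A_def)
  obtain i0 m0 where i0: "i0 \<le> N" "m0 \<in> Poly_Mapping.keys (F i0)"
    using assms by (metis equals0I keys_eq_empty)
  have "Poly_Mapping.lookup (F i0) m0 \<in> A" "Poly_Mapping.lookup (F i0) m0 \<noteq> 0"
    using i0 in_keys_lookup_in_range[OF i0(2)] unfolding A_def by (blast, simp add: in_keys_iff)
  hence "\<exists>x\<in>A. x \<noteq> 0" by blast
  from rats_eq_scaled_coprime_ints[OF fin this]
  obtain c :: rat and z where c: "c \<noteq> 0" and z: "\<And>x. x \<in> A \<Longrightarrow> x = c * of_int (z x)"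
    and gcd: "Gcd (z ` A) = 1" by metis
  define G where "G = (\<lambda>i. Poly_Mapping.map z (F i))"
  have A: "Poly_Mapping.lookup (F i) m \<in> A" if "i \<le> N" "Poly_Mapping.lookup (F i) m \<noteq> 0" for i m
    using that in_keys_lookup_in_range[of m "F i"] unfolding A_def in_keys_iff by blast
  have z0: "z (Poly_Mapping.lookup (F i) m) \<noteq> 0"
    if "i \<le> N" "Poly_Mapping.lookup (F i) m \<noteq> 0" for i m
    using z[OF A[OF that]] that by auto
  have "F i = Poly_Mapping.map (\<lambda>a. c * of_int a) (G i)" if i: "i \<le> N" for i
  proof (rule poly_mapping_eqI)
    fix m
    show "Poly_Mapping.lookup (F i) m = Poly_Mapping.lookup (Poly_Mapping.map (\<lambda>a. c * of_int a) (G i)) m"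
      using z[OF A[OF i, of m]] z0[OF i, of m] by (simp add: G_def lookup_map)
  qed
  moreover have "(\<Union>i\<le>N. Poly_Mapping.range (G i)) = z ` A"
  proof -
    have "Poly_Mapping.range (G i) = z ` Poly_Mapping.range (F i)" if i: "i \<le> N" for i
    proof (intro equalityI subsetI)
      fix y assume "y \<in> Poly_Mapping.range (G i)"
      then obtain m where m: "y = Poly_Mapping.lookup (G i) m" "y \<noteq> 0"
        by (auto simp: Poly_Mapping.range.rep_eq)
      thus "y \<in> z ` Poly_Mapping.range (F i)"
        by (auto simp: G_def lookup_map Poly_Mapping.range.rep_eq split: if_splits)
    next
      fix y assume "y \<in> z ` Poly_Mapping.range (F i)"
      then obtain m where m: "Poly_Mapping.lookup (F i) m \<noteq> 0" "y = z (Poly_Mapping.lookup (F i) m)"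
        by (auto simp: Poly_Mapping.range.rep_eq)
      hence "y = Poly_Mapping.lookup (G i) m" "y \<noteq> 0"
        using z0[OF i m(1)] by (simp_all add: G_def lookup_map)
      thus "y \<in> Poly_Mapping.range (G i)" by (auto simp: Poly_Mapping.range.rep_eq)
    qed
    thus ?thesis unfolding A_def image_UN by simp
  qed
  ultimately show ?thesis using c gcd unfolding primitive_model_def by metis
qed

lemma exists_coprime_coords:
  assumes "x \<in> proj_coords N rat_field"
  obtains a :: "nat \<Rightarrow> int" where "Gcd (a ` {..N}) = 1"
    "(x, \<lambda>i\<in>{..N}. of_int (a i)) \<in> proj_rel N rat_field"
proof -
  have "\<exists>y\<in>x ` {..N}. y \<noteq> 0" using assms by (auto simp: proj_coords_def rat_field_simps)
  from rats_eq_scaled_coprime_ints[OF _ this]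
  obtain c :: rat and z where c: "c \<noteq> 0" and z: "\<And>y. y \<in> x ` {..N} \<Longrightarrow> y = c * of_int (z y)"
    and gcd: "Gcd (z ` x ` {..N}) = 1" by auto
  have a: "of_int (z (x i)) = inverse c * x i" if "i \<le> N" for i
    using z[of "x i"] that c by (simp add: field_simps)
  obtain i where i: "i \<le> N" "x i \<noteq> 0" using assms by (auto simp: proj_coords_def rat_field_simps)
  have "(\<lambda>i\<in>{..N}. of_int (z (x i))) \<in> proj_coords N rat_field"
    using i a[OF i(1)] c by (auto simp: proj_coords_def rat_field_simps intro!: exI[of _ i])
  hence "(x, \<lambda>i\<in>{..N}. of_int (z (x i))) \<in> proj_rel N rat_field"
    using assms c a unfolding proj_rel_def
    by (auto simp: rat_field_simps intro!: exI[of _ "inverse c"])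
  thus ?thesis using that[of "z \<circ> x"] gcd by (simp add: image_comp)
qed

text \<open>
  Two coprime integer coordinate vectors of the same point differ by a rational factor; comparing
  greatest common divisors shows that this factor is \<open>1\<close> or \<open>-1\<close>, and \<open>-1\<close> becomes the nonzero
  scalar \<open>p - 1\<close> modulo \<open>p\<close>.
\<close>

lemma reduce_point_eq:
  assumes p: "Factorial_Ring.prime p" and gcd: "Gcd (a ` {..N}) = 1"
    and P: "P = proj_rel N rat_field `` {\<lambda>i\<in>{..N}. of_int (a i)}"
  shows "reduce_point p N P = proj_rel N (prime_field p) `` {\<lambda>i\<in>{..N}. a i mod int p}"
proof -
  let ?r = "\<lambda>b. \<lambda>i\<in>{..N}. b i mod int p"
  have p1: "int p > 1" using prime_gt_1_nat[OF p] by simp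
  have coords: "?r b \<in> proj_coords N (prime_field p)" if "Gcd (b ` {..N}) = 1" for b
  proof -
    have "\<exists>i\<le>N. b i mod int p \<noteq> 0"
    proof (rule ccontr)
      assume "\<not> ?thesis"
      hence "int p dvd Gcd (b ` {..N})" by (intro Gcd_greatest) (auto simp: dvd_eq_mod_eq_0)
      thus False using that p1 by simp
    qed
    thus ?thesis using p1 by (auto simp: proj_coords_def prime_field_simps)
  qed
  have eq: "proj_rel N (prime_field p) `` {?r b} = proj_rel N (prime_field p) `` {?r a}"
    if b: "Gcd (b ` {..N}) = 1" "(\<lambda>i\<in>{..N}. of_int (b i)) \<in> P" for b
  proof -
    obtain t :: rat where t: "\<And>i. i \<le> N \<Longrightarrow> of_int (b i) = t * of_int (a i)"
      using b(2) unfolding P by (auto simp: proj_rel_def rat_field_simps)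
    obtain u v where uv: "t = of_int u / of_int v" "v > 0"
      by (metis quotient_of_div quotient_of_denom_pos surj_pair)
    have vb: "v * b i = u * a i" if "i \<le> N" for i
    proof -
      have "(of_int (v * b i) :: rat) = of_int (u * a i)"
        using t[OF that] uv by (simp add: field_simps)
      thus ?thesis by (simp only: of_int_eq_iff)
    qed
    have "(*) v ` (b ` {..N}) = (*) u ` (a ` {..N})"
      unfolding image_image using vb by (intro image_cong) auto
    hence "normalize (v * Gcd (b ` {..N})) = normalize (u * Gcd (a ` {..N}))" by (metis Gcd_mult)
    hence "\<bar>v\<bar> = \<bar>u\<bar>" using b(1) gcd by simp
    hence "u = v \<or> u = - v" by linarith
    thus ?thesis
    proof
      assume "u = v"
      hence "?r b = ?r a" using vb uv by (intro restrict_ext) auto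
      thus ?thesis by simp
    next
      assume u: "u = - v"
      have ba: "b i = - a i" if "i \<le> N" for i
      proof -
        have "v * b i = v * - a i" using vb[OF that] u by simp
        thus ?thesis using uv by (simp only: mult_cancel_left) simp
      qed
      have "(?r a, ?r b) \<in> proj_rel N (prime_field p)"
      proof -
        have "b i mod int p = ((int p - 1) * (a i mod int p)) mod int p" if "i \<le> N" for i
        proof -
          have "((int p - 1) * (a i mod int p)) mod int p = ((int p - 1) * a i) mod int p"
            by (rule mod_mult_right_eq)
          also have "(int p - 1) * a i = b i + a i * int p" using ba[OF that] by (simp add: algebra_simps)
          finally show ?thesis by simp
        qed
        thus ?thesis unfolding proj_rel_def
          using coords[OF gcd] coords[OF b(1)] p1
          by (auto simp: prime_field_simps intro!: bexI[of _ "int p - 1"])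
      qed
      thus ?thesis by (rule equiv_class_eq[OF proj_rel_equiv[OF prime_field_field[OF p]], symmetric])
    qed
  qed
  have self: "(\<lambda>i\<in>{..N}. of_int (a i)) \<in> P"
  proof -
    have "(\<lambda>i\<in>{..N}. of_int (a i)) \<in> proj_coords N rat_field"
    proof -
      have "\<exists>i\<le>N. a i \<noteq> 0"
      proof (rule ccontr)
        assume "\<not> ?thesis"
        hence "a ` {..N} \<subseteq> {0}" by auto
        thus False using gcd by (simp add: Gcd_0_iff [symmetric])
      qed
      thus ?thesis by (auto simp: proj_coords_def rat_field_simps)
    qed
    thus ?thesis unfolding P by (rule equiv_class_self[OF proj_rel_equiv[OF rat_field]])
  qed
  define B where "B = {?r b | b. Gcd (b ` {..N}) = 1 \<and> (\<lambda>i\<in>{..N}. of_int (b i)) \<in> P}"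
  have "?r a \<in> B" using gcd self unfolding B_def by blast
  moreover have "proj_rel N (prime_field p) `` {y} = proj_rel N (prime_field p) `` {?r a}" if "y \<in> B" for y
    using that eq unfolding B_def by blast
  ultimately have "proj_rel N (prime_field p) `` B = proj_rel N (prime_field p) `` {?r a}"
    by blast
  thus "reduce_point p N P = proj_rel N (prime_field p) `` {?r a}"
    by (simp add: reduce_point_def B_def)
qed

lemma proportional_mod_prime_minor:
  assumes "(\<lambda>i\<in>{..N}. a i mod int p, \<lambda>i\<in>{..N}. b i mod int p) \<in> proj_rel N (prime_field p)"
    and "k \<le> N" "l \<le> N"
  shows "int p dvd a k * b l - a l * b k"
proof -
  obtain t where t: "\<And>i. i \<le> N \<Longrightarrow> b i mod int p = (t * (a i mod int p)) mod int p"
    using assms(1) by (auto simp: proj_rel_def prime_field_simps)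
  have b: "[b i = t * a i] (mod int p)" if "i \<le> N" for i
    using t[OF that] by (simp add: cong_def mod_mult_right_eq)
  have "[a k * b l = a k * (t * a l)] (mod int p)" "[a l * (t * a k) = a l * b k] (mod int p)"
    using cong_scalar_left[OF b[OF assms(3)], of "a k"]
      cong_scalar_left[OF cong_sym[OF b[OF assms(2)]], of "a l"] .
  moreover have "a k * (t * a l) = a l * (t * a k)" by simp
  ultimately have "[a k * b l = a l * b k] (mod int p)" by (metis cong_trans)
  thus ?thesis by (simp add: cong_iff_dvd_diff)
qed

lemma rat_minor_nonzero:
  fixes a b :: "nat \<Rightarrow> int"
  assumes "(\<lambda>i\<in>{..N}. of_int (a i)) \<in> proj_coords N rat_field"
    "(\<lambda>i\<in>{..N}. of_int (b i)) \<in> proj_coords N rat_field"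
    "(\<lambda>i\<in>{..N}. of_int (a i), \<lambda>i\<in>{..N}. of_int (b i)) \<notin> proj_rel N rat_field"
  shows "\<exists>k\<le>N. \<exists>l\<le>N. a k * b l - a l * b k \<noteq> 0"
proof (rule ccontr)
  assume "\<not> ?thesis"
  hence z: "a k * b l = a l * b k" if "k \<le> N" "l \<le> N" for k l using that by auto
  obtain k where k: "k \<le> N" "b k \<noteq> 0" using assms(2) by (auto simp: proj_coords_def rat_field_simps)
  obtain j where j: "j \<le> N" "a j \<noteq> 0" using assms(1) by (auto simp: proj_coords_def rat_field_simps)
  have ak: "a k \<noteq> 0" using z[OF k(1) j(1)] k j by auto
  define t :: rat where "t = of_int (b k) / of_int (a k)"
  have "t \<noteq> 0" using k ak by (simp add: t_def)
  moreover have "of_int (b l) = t * of_int (a l)" if "l \<le> N" for l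
  proof -
    have "(of_int (a k * b l) :: rat) = of_int (a l * b k)" using z[OF k(1) that] by simp
    thus ?thesis using ak by (simp add: t_def field_simps)
  qed
  ultimately have "(\<lambda>i\<in>{..N}. of_int (a i), \<lambda>i\<in>{..N}. of_int (b i)) \<in> proj_rel N rat_field"
    unfolding proj_rel_def using assms(1,2) by (auto simp: rat_field_simps intro!: exI[of _ t])
  thus False using assms(3) by blast
qed

section \<open>The integer orbit\<close>

text \<open>
  Common factors of the coordinates are kept, so that reduction modulo any prime commutes with
  iteration.
\<close>

definition int_orbit :: "(nat \<Rightarrow> int mpoly) \<Rightarrow> (nat \<Rightarrow> int) \<Rightarrow> nat \<Rightarrow> nat \<Rightarrow> int" where
  "int_orbit G a n = ((\<lambda>b i. int_eval (G i) b) ^^ n) a"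

lemma int_orbit_0: "int_orbit G a 0 = a"
  by (simp add: int_orbit_def)

lemma int_orbit_Suc: "int_orbit G a (Suc n) i = int_eval (G i) (int_orbit G a n)"
  by (simp add: int_orbit_def)

lemma primitive_model_scale:
  assumes "primitive_model N F G"
  obtains c :: rat where "c \<noteq> 0" "\<And>i. i \<le> N \<Longrightarrow> F i = Poly_Mapping.map (\<lambda>a. c * of_int a) (G i)"
  using assms unfolding primitive_model_def by blast

lemma primitive_model_homogeneous:
  assumes "primitive_model N F G" "\<forall>i\<le>N. homogeneous_mpoly N d (F i)"
  shows "\<forall>i\<le>N. homogeneous_mpoly N d (G i)"
proof (intro allI impI)
  fix i assume i: "i \<le> N"
  obtain c :: rat where c: "c \<noteq> 0" "F i = Poly_Mapping.map (\<lambda>a. c * of_int a) (G i)"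
    using assms(1) i unfolding primitive_model_def by blast
  have "Poly_Mapping.keys (F i) = Poly_Mapping.keys (G i)"
    using c by (auto simp: in_keys_iff lookup_map)
  thus "homogeneous_mpoly N d (G i)"
    using assms(2) i by (auto simp: homogeneous_mpoly_def)
qed

text \<open>
  The empty set is a fixed point of the map on classes.  A common zero met along the orbit
  therefore makes the orbit finite.
\<close>

lemma finite_forward_orbit_if_empty_image:
  assumes "proj_map N K F Q = {}" "Q = (proj_map N K F ^^ n) P"
  shows "finite (forward_orbit (proj_map N K F) P)"
proof (rule finite_forward_orbit_if_repeats)
  have "(proj_map N K F ^^ Suc n) P = {}" using assms by simp
  moreover have "proj_map N K F {} = {}" by (simp add: proj_map_def)
  ultimately show "(proj_map N K F ^^ Suc n) P = (proj_map N K F ^^ Suc (Suc n)) P" by simp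
qed simp

text \<open>
  A primitive integer model exists only for a nonzero map, and the zero map sends every class to
  the empty set.
\<close>

lemma infinite_orbit_nonzero_map:
  assumes "infinite (forward_orbit (proj_map N rat_field F) P)" "P \<in> proj_space N rat_field"
    and hom: "\<forall>i\<le>N. homogeneous_mpoly N d (F i)"
  shows "\<exists>i\<le>N. F i \<noteq> 0"
proof (rule ccontr)
  assume "\<not> ?thesis"
  hence z: "F i = 0" if "i \<le> N" for i using that by blast
  obtain x where x: "x \<in> proj_coords N rat_field" "P = proj_rel N rat_field `` {x}"
    using assms(2) unfolding proj_space_def by (auto elim: quotientE)
  have "mpoly_eval rat_field id (F i) x = 0" if "i \<le> N" for i
    unfolding mpoly_eval_def z[OF that] by (simp add: rat_field_finsum)
  hence "(\<lambda>i\<in>{..N}. mpoly_eval rat_field id (F i) x) \<notin> proj_coords N rat_field"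
    by (auto simp: proj_coords_def rat_field_simps)
  moreover have "proj_map N rat_field F P
      = proj_rel N rat_field `` {\<lambda>i\<in>{..N}. mpoly_eval rat_field id (F i) x}"
    unfolding x(2) by (rule proj_map_class[OF rat_field x(1) hom]) (simp add: rat_field_simps)
  ultimately have "proj_map N rat_field F P = {}" by (auto simp: proj_rel_def)
  from finite_forward_orbit_if_empty_image[OF this, of 0] show False using assms(1) by simp
qed

text \<open>
  The integer vectors never vanish: a first zero would mean a common zero of the forms on the
  orbit, which would then be finite.
\<close>

lemma rat_orbit_class:
  assumes hom: "\<forall>i\<le>N. homogeneous_mpoly N d (F i)"
    and G: "primitive_model N F G"
    and a: "(\<lambda>i\<in>{..N}. of_int (a i)) \<in> proj_coords N rat_field"
      "P = proj_rel N rat_field `` {\<lambda>i\<in>{..N}. of_int (a i)}"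
    and inf: "infinite (forward_orbit (proj_map N rat_field F) P)"
  defines "v \<equiv> (\<lambda>n. \<lambda>i\<in>{..N}. of_int (int_orbit G a n i) :: rat)"
  shows "v n \<in> proj_coords N rat_field \<and> (proj_map N rat_field F ^^ n) P = proj_rel N rat_field `` {v n}"
proof (induction n)
  case 0
  have v0: "v 0 = (\<lambda>i\<in>{..N}. of_int (a i))" by (simp only: v_def int_orbit_0)
  show ?case unfolding v0 funpow_0 using a by blast
next
  case (Suc n)
  obtain c :: rat where c: "c \<noteq> 0" "\<And>i. i \<le> N \<Longrightarrow> F i = Poly_Mapping.map (\<lambda>a. c * of_int a) (G i)"
    using G primitive_model_scale by blast
  let ?w = "\<lambda>i\<in>{..N}. mpoly_eval rat_field id (F i) (v n)"
  have w: "?w i = c * v (Suc n) i" if "i \<le> N" for i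
    using rat_mpoly_eval[OF c(2)[OF that] c(1), of N d "v n" "int_orbit G a n"] hom that
    by (simp add: v_def int_orbit_Suc)
  have img: "proj_map N rat_field F (proj_rel N rat_field `` {v n}) = proj_rel N rat_field `` {?w}"
    by (rule proj_map_class[OF rat_field _ hom]) (use Suc.IH in \<open>simp_all add: rat_field_simps\<close>)
  have nz: "\<exists>i\<le>N. ?w i \<noteq> 0"
  proof (rule ccontr)
    assume "\<not> ?thesis"
    hence "?w \<notin> proj_coords N rat_field" unfolding proj_coords_def rat_field_simps by blast
    hence "proj_rel N rat_field `` {?w} = {}" unfolding proj_rel_def by blast
    with img have "proj_map N rat_field F (proj_rel N rat_field `` {v n}) = {}" by simp
    from finite_forward_orbit_if_empty_image[OF this, of n P] show False using inf Suc.IH by simp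
  qed
  have wc: "?w \<in> proj_coords N rat_field"
    using nz unfolding proj_coords_def rat_field_simps by simp
  have "\<exists>i\<le>N. v (Suc n) i \<noteq> 0" using nz w c by (metis mult_zero_right)
  hence vc: "v (Suc n) \<in> proj_coords N rat_field"
    unfolding proj_coords_def rat_field_simps by (simp add: v_def)
  have "v (Suc n) i = inverse c * ?w i" if "i \<le> N" for i
    unfolding w[OF that] using c by simp
  hence "(?w, v (Suc n)) \<in> proj_rel N rat_field"
    unfolding proj_rel_def rat_field_simps using wc vc c(1) 
    by (intro CollectI case_prodI conjI bexI[of _ "inverse c"]) auto
  hence "proj_rel N rat_field `` {?w} = proj_rel N rat_field `` {v (Suc n)}"
    by (rule equiv_class_eq[OF proj_rel_equiv[OF rat_field]])
  thus ?case using vc img Suc.IH by simp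
qed

lemma int_orbit_minor_nonzero:
  assumes hom: "\<forall>i\<le>N. homogeneous_mpoly N d (F i)"
    and G: "primitive_model N F G"
    and a: "(\<lambda>i\<in>{..N}. of_int (a i)) \<in> proj_coords N rat_field"
      "P = proj_rel N rat_field `` {\<lambda>i\<in>{..N}. of_int (a i)}"
    and inf: "infinite (forward_orbit (proj_map N rat_field F) P)"
    and mn: "m < n"
  shows "\<exists>k\<le>N. \<exists>l\<le>N. int_orbit G a m k * int_orbit G a n l - int_orbit G a m l * int_orbit G a n k \<noteq> 0"
proof -
  note cl = rat_orbit_class[OF hom G a inf]
  show ?thesis
  proof (rule rat_minor_nonzero)
    show "(\<lambda>i\<in>{..N}. of_int (int_orbit G a m i), \<lambda>i\<in>{..N}. of_int (int_orbit G a n i))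
        \<notin> proj_rel N rat_field" 
    proof
      assume "(\<lambda>i\<in>{..N}. of_int (int_orbit G a m i), \<lambda>i\<in>{..N}. of_int (int_orbit G a n i))
        \<in> proj_rel N rat_field"
      from equiv_class_eq[OF proj_rel_equiv[OF rat_field] this]
      have "(proj_map N rat_field F ^^ m) P = (proj_map N rat_field F ^^ n) P"
        using cl[of m] cl[of n] by simp
      from finite_forward_orbit_if_repeats[OF mn this] show False using inf by blast
    qed
  qed (use cl[of m] cl[of n] in blast)+
qed

lemma finite_forward_orbit_prime_field:
  "finite (forward_orbit (proj_map N (prime_field p) F) (reduce_point p N P))"
proof (rule finite_subset)
  have sub: "proj_rel N (prime_field p) `` B \<subseteq> proj_coords N (prime_field p)" for B
    unfolding proj_rel_def by blast
  have "(proj_map N (prime_field p) F ^^ n) (reduce_point p N P) \<subseteq> proj_coords N (prime_field p)" for n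
    by (cases n) (simp_all add: sub proj_map_def reduce_point_def)
  thus "forward_orbit (proj_map N (prime_field p) F) (reduce_point p N P) \<subseteq> Pow (proj_coords N (prime_field p))"
    by (auto simp: forward_orbit_def)
  have "proj_coords N (prime_field p) \<subseteq> PiE {..N} (\<lambda>_. {0..<int p})"
    unfolding proj_coords_def prime_field_simps by blast
  moreover have "finite (PiE {..N} (\<lambda>_. {0..<int p}))" by (intro finite_PiE) auto
  ultimately show "finite (Pow (proj_coords N (prime_field p)))"
    by (metis finite_Pow_iff finite_subset)
qed

text \<open>
  A nonzero minor modulo \<open>p\<close> shows at once that both vectors are nonzero modulo \<open>p\<close> and that they
  give different points.  Pairs up to index \<open>M + 1\<close> are used, not \<open>M\<close>, so that every index belongs
  to a pair even when \<open>M = 0\<close>.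
\<close>

lemma orbit_size_mod_ge:
  fixes a :: "nat \<Rightarrow> int"
  assumes p: "Factorial_Ring.prime p"
    and hom: "\<forall>i\<le>N. homogeneous_mpoly N d (G i)"
    and G: "G = (SOME G. primitive_model N F G)"
    and gcd: "Gcd (a ` {..N}) = 1"
    and P: "P = proj_rel N rat_field `` {\<lambda>i\<in>{..N}. of_int (a i)}"
    and minors: "\<And>m n. m < n \<Longrightarrow> n \<le> Suc M \<Longrightarrow> \<exists>k\<le>N. \<exists>l\<le>N.
      \<not> int p dvd int_orbit G a m k * int_orbit G a n l - int_orbit G a m l * int_orbit G a n k"
  shows "orbit_size_mod N d F P p \<ge> enat (Suc M)"
proof (cases "proj_morphism N d (prime_field p) (reduce_map p N F)")
  case True
  let ?K = "prime_field p" and ?F = "reduce_map p N F"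
  define v where "v = (\<lambda>n. \<lambda>i\<in>{..N}. int_orbit G a n i mod int p)"
  have K: "field ?K" by (rule prime_field_field[OF p])
  have p0: "int p > 0" using prime_gt_0_nat[OF p] by simp
  have F: "?F i = Poly_Mapping.map (\<lambda>a. a mod int p) (G i)" for i
    by (simp add: reduce_map_def G)
  have hom': "\<forall>i\<le>N. homogeneous_mpoly N d (?F i)" using True by (simp add: proj_morphism_def)
  have carr: "\<forall>i\<le>N. \<forall>m\<in>Poly_Mapping.keys (?F i). Poly_Mapping.lookup (?F i) m \<in> carrier ?K"
    using p0 by (simp add: F lookup_map prime_field_simps)
  have v: "v n \<in> proj_coords N ?K" if n: "n \<le> Suc M" for n
  proof -
    have "\<exists>i\<le>N. \<not> int p dvd int_orbit G a n i"
    proof (cases "n = 0")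
      case True
      from minors[of 0 1] obtain k l where kl: "k \<le> N" "l \<le> N"
        "\<not> int p dvd int_orbit G a 0 k * int_orbit G a 1 l - int_orbit G a 0 l * int_orbit G a 1 k" by auto
      hence "\<not> (int p dvd int_orbit G a 0 k \<and> int p dvd int_orbit G a 0 l)" by auto
      thus ?thesis using kl True by blast
    next
      case False
      from minors[of 0 n] False n obtain k l where kl: "k \<le> N" "l \<le> N"
        "\<not> int p dvd int_orbit G a 0 k * int_orbit G a n l - int_orbit G a 0 l * int_orbit G a n k" by auto
      hence "\<not> (int p dvd int_orbit G a n k \<and> int p dvd int_orbit G a n l)" by auto
      thus ?thesis using kl by blast
    qed
    thus ?thesis using p0 by (auto simp: proj_coords_def prime_field_simps v_def dvd_eq_mod_eq_0)
  qed
  have step: "(\<lambda>i\<in>{..N}. mpoly_eval ?K id (?F i) (v n)) = v (Suc n)" for n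
    unfolding v_def
  proof (rule restrict_ext)
    fix i assume "i \<in> {..N}"
    hence "homogeneous_mpoly N d (G i)" using hom by simp
    thus "mpoly_eval ?K id (?F i) (\<lambda>i\<in>{..N}. int_orbit G a n i mod int p) = int_orbit G a (Suc n) i mod int p"
      unfolding F int_orbit_Suc
      by (intro prime_field_mpoly_eval[OF p homogeneous_mpoly_keys]) auto
  qed
  have start: "reduce_point p N P = proj_rel N ?K `` {v 0}"
    using reduce_point_eq[OF p gcd P] by (simp add: v_def int_orbit_0)
  have iter: "(proj_map N ?K ?F ^^ n) (reduce_point p N P) = proj_rel N ?K `` {v n}" if "n \<le> Suc M" for n
    unfolding start
  proof (rule proj_map_iterate_class[OF K hom' carr _ _ that])
    show "\<forall>n\<le>Suc M. v n \<in> proj_coords N ?K" using v by blast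
    have "(v (Suc n), v (Suc n)) \<in> proj_rel N ?K" if "n < Suc M" for n
      using equiv_class_self[OF proj_rel_equiv[OF K] v[of "Suc n"]] that by simp
    thus "\<forall>n<Suc M. (\<lambda>i\<in>{..N}. mpoly_eval ?K id (?F i) (v n), v (Suc n)) \<in> proj_rel N ?K"
      unfolding step by blast
  qed
  have distinct: "proj_rel N ?K `` {v m} \<noteq> proj_rel N ?K `` {v n}" if mn: "m < n" "n \<le> Suc M" for m n
  proof
    assume "proj_rel N ?K `` {v m} = proj_rel N ?K `` {v n}"
    hence "(v m, v n) \<in> proj_rel N ?K"
      using eq_equiv_class[OF _ proj_rel_equiv[OF K]] v mn by blast
    thus False using minors[OF mn] proportional_mod_prime_minor unfolding v_def by blast
  qed
  have "inj_on (\<lambda>n. (proj_map N ?K ?F ^^ n) (reduce_point p N P)) {..Suc M}"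
  proof (rule linorder_inj_onI)
    fix m n assume "m < n" "m \<in> {..Suc M}" "n \<in> {..Suc M}"
    thus "(proj_map N ?K ?F ^^ m) (reduce_point p N P) \<noteq> (proj_map N ?K ?F ^^ n) (reduce_point p N P)"
      using iter distinct by simp
  qed auto
  from card_forward_orbit_ge[OF finite_forward_orbit_prime_field this]
  show ?thesis using True by (simp add: orbit_size_mod_def)
qed (simp add: orbit_size_mod_def)

section \<open>Growth of the orbit and its minors\<close>

lemma int_eval_bound:
  assumes hom: "homogeneous_mpoly N d g" and a: "\<And>i. i \<le> N \<Longrightarrow> \<bar>a i\<bar> \<le> H"
  shows "\<bar>int_eval g a\<bar> \<le> (\<Sum>m\<in>Poly_Mapping.keys g. \<bar>Poly_Mapping.lookup g m\<bar>) * H ^ d"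
proof -
  have "\<bar>int_eval g a\<bar> \<le> (\<Sum>m\<in>Poly_Mapping.keys g. \<bar>Poly_Mapping.lookup g m *
     (\<Prod>i\<in>Poly_Mapping.keys m. a i ^ Poly_Mapping.lookup m i)\<bar>)"
    unfolding int_eval_def by (rule sum_abs)
  also have "\<dots> \<le> (\<Sum>m\<in>Poly_Mapping.keys g. \<bar>Poly_Mapping.lookup g m\<bar> * H ^ d)"
  proof (rule sum_mono)
    fix m assume m: "m \<in> Poly_Mapping.keys g"
    have "\<bar>\<Prod>i\<in>Poly_Mapping.keys m. a i ^ Poly_Mapping.lookup m i\<bar>
        = (\<Prod>i\<in>Poly_Mapping.keys m. \<bar>a i\<bar> ^ Poly_Mapping.lookup m i)"
      by (simp add: abs_prod power_abs)
    also have "\<dots> \<le> (\<Prod>i\<in>Poly_Mapping.keys m. H ^ Poly_Mapping.lookup m i)"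
    proof (rule prod_mono)
      fix i assume "i \<in> Poly_Mapping.keys m"
      hence "i \<le> N" using homogeneous_mpoly_keys[OF hom] m by blast
      thus "0 \<le> \<bar>a i\<bar> ^ Poly_Mapping.lookup m i \<and> \<bar>a i\<bar> ^ Poly_Mapping.lookup m i \<le> H ^ Poly_Mapping.lookup m i"
        using a by (auto intro: power_mono)
    qed
    also have "\<dots> = H ^ d"
      using hom m by (simp add: power_sum [symmetric] homogeneous_mpoly_def)
    finally show "\<bar>Poly_Mapping.lookup g m * (\<Prod>i\<in>Poly_Mapping.keys m. a i ^ Poly_Mapping.lookup m i)\<bar>
        \<le> \<bar>Poly_Mapping.lookup g m\<bar> * H ^ d"
      by (simp add: abs_mult mult_left_mono)
  qed
  finally show ?thesis by (simp add: sum_distrib_right)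
qed

text \<open>
  The exponent base is \<open>d + 2\<close>: of the quantity \<open>S \<bar>u\<^sub>n\<bar>\<close>, where \<open>S\<close> bounds the coefficient sums,
  one step takes the \<open>d\<close>-th power and costs at most two further factors of the previous bound.  It
  also keeps the base at least \<open>2\<close> in small degrees.
\<close>

lemma int_orbit_bound:
  assumes hom: "\<forall>i\<le>N. homogeneous_mpoly N d (G i)"
  obtains T :: int where "T \<ge> 1" "\<And>n i. i \<le> N \<Longrightarrow> \<bar>int_orbit G a n i\<bar> \<le> T ^ ((d + 2) ^ n)"
proof -
  define S where "S = 1 + (\<Sum>i\<le>N. \<Sum>m\<in>Poly_Mapping.keys (G i). \<bar>Poly_Mapping.lookup (G i) m\<bar>)"
  define T where "T = S * (1 + (\<Sum>i\<le>N. \<bar>a i\<bar>))"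
  have S1: "S \<ge> 1" by (simp add: S_def sum_nonneg)
  have S: "(\<Sum>m\<in>Poly_Mapping.keys (G i). \<bar>Poly_Mapping.lookup (G i) m\<bar>) \<le> S" if "i \<le> N" for i
    using member_le_sum[of i "{..N}" "\<lambda>i. \<Sum>m\<in>Poly_Mapping.keys (G i). \<bar>Poly_Mapping.lookup (G i) m\<bar>"] that
    by (simp add: S_def sum_nonneg)
  have T1: "1 + (\<Sum>i\<le>N. \<bar>a i\<bar>) \<ge> 1" by (simp add: sum_nonneg)
  have ST: "S \<le> T" using mult_left_mono[OF T1, of S] S1 by (simp add: T_def)
  have bound: "S * \<bar>int_orbit G a n i\<bar> \<le> T ^ ((d + 2) ^ n)" if "i \<le> N" for n i
    using that
  proof (induction n arbitrary: i)
    case 0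
    have "\<bar>a i\<bar> \<le> 1 + (\<Sum>i\<le>N. \<bar>a i\<bar>)"
      using member_le_sum[of i "{..N}" "\<lambda>i. \<bar>a i\<bar>"] 0 by simp
    thus ?case using S1 by (simp add: int_orbit_0 T_def mult_left_mono)
  next
    case (Suc n)
    define U where "U = T ^ ((d + 2) ^ n)"
    have U: "U \<ge> S"
    proof -
      have "T ^ 1 \<le> U" unfolding U_def using ST S1 by (intro power_increasing) auto
      thus ?thesis using ST by simp
    qed
    have "\<bar>int_orbit G a n i\<bar> \<le> U" if "i \<le> N" for i
    proof -
      have "1 * \<bar>int_orbit G a n i\<bar> \<le> S * \<bar>int_orbit G a n i\<bar>" using S1 by (intro mult_right_mono) auto
      thus ?thesis using Suc.IH[OF that] by (simp add: U_def)
    qed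
    hence "\<bar>int_orbit G a (Suc n) i\<bar> \<le>
        (\<Sum>m\<in>Poly_Mapping.keys (G i). \<bar>Poly_Mapping.lookup (G i) m\<bar>) * U ^ d"
      unfolding int_orbit_Suc using hom Suc.prems by (intro int_eval_bound[of N]) auto
    also have "\<dots> \<le> S * U ^ d"
      using S[OF Suc.prems] U S1 by (intro mult_right_mono) auto
    also have "\<dots> \<le> U * U ^ d" using U S1 by (intro mult_right_mono) auto
    finally have "S * \<bar>int_orbit G a (Suc n) i\<bar> \<le> U * (U * U ^ d)"
      using U S1 by (intro mult_mono) auto
    also have "\<dots> = T ^ ((d + 2) ^ Suc n)" 
      by (simp add: U_def power_mult [symmetric] power_add mult.commute)
    finally show ?case .
  qed
  show ?thesis
  proof (rule that[of T])
    show "T \<ge> 1" using ST S1 by simp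
    fix n i assume "i \<le> N"
    have "1 * \<bar>int_orbit G a n i\<bar> \<le> S * \<bar>int_orbit G a n i\<bar>" using S1 by (intro mult_right_mono) auto
    thus "\<bar>int_orbit G a n i\<bar> \<le> T ^ ((d + 2) ^ n)" using bound[OF \<open>i \<le> N\<close>, of n] by simp
  qed
qed

text \<open>
  Distinct primes dividing \<open>D\<close> have a product dividing \<open>D\<close>.
\<close>

lemma sum_ln_prime_divisors_le:
  fixes D :: nat
  assumes "finite A" "D > 0" "\<And>p. p \<in> A \<Longrightarrow> Factorial_Ring.prime p \<and> p dvd D"
  shows "(\<Sum>p\<in>A. ln (real p)) \<le> ln (real D)"
proof -
  have "(\<Prod>p\<in>B. p) dvd D" if "B \<subseteq> A" for B
  proof -
    have "finite B" using that assms(1) by (rule finite_subset)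
    thus ?thesis using that
    proof (induction B rule: finite_induct)
      case (insert p B)
      have p: "Factorial_Ring.prime p" "p dvd D" using insert.prems assms(3) by auto
      have "Rings.coprime p (\<Prod>q\<in>B. q)"
      proof (rule prod_coprime_right)
        fix q assume "q \<in> B"
        hence "Factorial_Ring.prime q" "q \<noteq> p" using insert assms(3) by auto
        thus "Rings.coprime p q" using p primes_coprime by blast
      qed
      hence "p * (\<Prod>q\<in>B. q) dvd D" using p insert by (intro divides_mult) auto
      thus ?case using insert.hyps by simp
    qed auto
  qed
  from this[of A] have "(\<Prod>p\<in>A. p) \<le> D" using assms(2) by (intro dvd_imp_le) auto
  hence le: "real (\<Prod>p\<in>A. p) \<le> real D" by (simp only: of_nat_le_iff)
  have pos: "real p > 0" if "p \<in> A" for p using assms(3)[OF that] prime_gt_0_nat by auto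
  have "(\<Sum>p\<in>A. ln (real p)) = ln (\<Prod>p\<in>A. real p)"
    using pos by (intro ln_prod [OF assms(1), symmetric]) (metis less_irrefl)
  also have "\<dots> \<le> ln (real D)"
    using le pos by (subst ln_le_cancel_iff) (auto intro: prod_pos assms(2) simp: assms(2))
  finally show ?thesis .
qed

text \<open>
  \<open>D M\<close> is the product of one nonzero minor for each pair of indices up to \<open>M + 1\<close>.  There are at
  most \<open>(M + 2)\<^sup>2\<close> of them, each with logarithm at most \<open>L (d + 2)\<^sup>M\<^sup>+\<^sup>1\<close>; the polynomial factor is
  absorbed by replacing the base \<open>d + 2\<close> with its cube.
\<close>

lemma collision_numbers:
  assumes mor: "proj_morphism N d rat_field F"
    and P: "P \<in> proj_space N rat_field"
    and inf: "infinite (forward_orbit (proj_map N rat_field F) P)"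
  obtains D :: "nat \<Rightarrow> nat" and K R :: real where "K \<ge> 0" "R > 1" "\<And>M. D M > 0"
    "\<And>M. ln (real (D M)) \<le> K * R ^ M"
    "\<And>M p. Factorial_Ring.prime p \<Longrightarrow> \<not> p dvd D M \<Longrightarrow> enat (Suc M) \<le> orbit_size_mod N d F P p"
proof -
  have homF: "\<forall>i\<le>N. homogeneous_mpoly N d (F i)" using mor by (simp add: proj_morphism_def)
  define G where "G = (SOME G. primitive_model N F G)"
  have G: "primitive_model N F G"
    unfolding G_def using exists_primitive_model[OF infinite_orbit_nonzero_map[OF inf P homF]]
    by (rule someI_ex)
  have homG: "\<forall>i\<le>N. homogeneous_mpoly N d (G i)" by (rule primitive_model_homogeneous[OF G homF])
  obtain x where x: "x \<in> proj_coords N rat_field" "P = proj_rel N rat_field `` {x}"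
    using P unfolding proj_space_def by (auto elim: quotientE)
  obtain a :: "nat \<Rightarrow> int" where gcd: "Gcd (a ` {..N}) = 1"
    and xa: "(x, \<lambda>i\<in>{..N}. of_int (a i)) \<in> proj_rel N rat_field"
    using exists_coprime_coords[OF x(1)] by metis
  have ac: "(\<lambda>i\<in>{..N}. of_int (a i)) \<in> proj_coords N rat_field"
    using xa unfolding proj_rel_def by blast
  have aP: "P = proj_rel N rat_field `` {\<lambda>i\<in>{..N}. of_int (a i)}"
    unfolding x(2) by (rule equiv_class_eq[OF proj_rel_equiv[OF rat_field] xa])
  define u where "u = int_orbit G a"
  define minor where "minor = (\<lambda>m n k l. u m k * u n l - u m l * u n k)"
  have "\<forall>m n. \<exists>k l. m < n \<longrightarrow> k \<le> N \<and> l \<le> N \<and> minor m n k l \<noteq> 0"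
    using int_orbit_minor_nonzero[OF homF G ac aP inf] unfolding minor_def u_def by blast
  then obtain k l where kl: "\<And>m n. m < n \<Longrightarrow> k m n \<le> N \<and> l m n \<le> N \<and> minor m n (k m n) (l m n) \<noteq> 0"
    by metis
  define \<mu> where "\<mu> = (\<lambda>m n. nat \<bar>minor m n (k m n) (l m n)\<bar>)"
  have \<mu>0: "\<mu> m n > 0" if "m < n" for m n using kl[OF that] by (simp add: \<mu>_def)
  define D where "D = (\<lambda>M. \<Prod>n\<le>Suc M. \<Prod>m<n. \<mu> m n)"
  have D0: "D M > 0" for M unfolding D_def by (intro prod_pos ballI \<mu>0) auto
  obtain T :: int where T: "T \<ge> 1" "\<And>n i. i \<le> N \<Longrightarrow> \<bar>u n i\<bar> \<le> T ^ ((d + 2) ^ n)"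
    using int_orbit_bound[OF homG] unfolding u_def by metis
  define B where "B = real (d + 2)"
  have B: "B \<ge> 2" by (simp add: B_def)
  define L where "L = ln 2 + 2 * ln (real_of_int T)"
  have L: "L \<ge> 0" using T(1) by (simp add: L_def)
  have ln\<mu>: "ln (real (\<mu> m n)) \<le> L * B ^ Suc M" if mn: "m < n" "n \<le> Suc M" for m n M
  proof -
    have uT: "\<bar>u j i\<bar> \<le> T ^ ((d + 2) ^ Suc M)" if "i \<le> N" "j \<le> Suc M" for i j
    proof -
      have "(d + 2) ^ j \<le> (d + 2) ^ Suc M" using that(2) by (intro power_increasing) auto
      hence "T ^ ((d + 2) ^ j) \<le> T ^ ((d + 2) ^ Suc M)" using T(1) by (rule power_increasing)
      with T(2)[OF that(1), of j] show ?thesis by (rule order_trans)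
    qed
    define V where "V = T ^ ((d + 2) ^ Suc M)"
    have "\<bar>minor m n (k m n) (l m n)\<bar> \<le> \<bar>u m (k m n)\<bar> * \<bar>u n (l m n)\<bar> + \<bar>u m (l m n)\<bar> * \<bar>u n (k m n)\<bar>"
      unfolding minor_def abs_mult [symmetric] by (rule abs_triangle_ineq4)
    also have "\<dots> \<le> V * V + V * V"
    proof -
      have kN: "k m n \<le> N" "l m n \<le> N" and mM: "m \<le> Suc M" using kl[OF mn(1)] mn by auto
      note uV = uT[folded V_def]
      have "0 \<le> V" using order_trans[OF abs_ge_zero uV[OF kN(1) mM]] .
      thus ?thesis by (intro add_mono mult_mono uV kN mM mn(2) abs_ge_zero)
    qed
    finally have "\<bar>minor m n (k m n) (l m n)\<bar> \<le> 2 * V^2" by (simp add: power2_eq_square)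
    hence "real_of_int \<bar>minor m n (k m n) (l m n)\<bar> \<le> real_of_int (2 * V^2)"
      by (simp only: of_int_le_iff)
    moreover have "real (\<mu> m n) = real_of_int \<bar>minor m n (k m n) (l m n)\<bar>"
      by (simp add: \<mu>_def)
    ultimately have \<mu>V: "real (\<mu> m n) \<le> 2 * real_of_int V ^ 2" by simp
    have \<mu>1: "real (\<mu> m n) > 0" using \<mu>0[OF mn(1)] by simp
    have V: "V \<ge> 1" using T(1) by (simp add: V_def)
    have "ln (real (\<mu> m n)) \<le> ln (2 * real_of_int V ^ 2)"
      using \<mu>V \<mu>1 by (simp only: ln_mono)
    also have "\<dots> = ln 2 + 2 * ln (real_of_int V)" using V by (simp add: ln_mult ln_realpow)
    also have "ln (real_of_int V) = B ^ Suc M * ln (real_of_int T)"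
    proof -
      have "real ((d + 2) ^ Suc M) = B ^ Suc M" by (simp only: B_def of_nat_power)
      thus ?thesis using T(1) by (simp only: V_def of_int_power ln_realpow)
    qed
    also have "ln 2 + 2 * (B ^ Suc M * ln (real_of_int T)) \<le> L * B ^ Suc M"
    proof -
      have "1 \<le> B ^ Suc M" using B by (intro one_le_power) simp
      from mult_left_mono[OF this, of "ln 2"] show ?thesis by (simp add: L_def algebra_simps)
    qed
    finally show ?thesis .
  qed
  have lnD: "ln (real (D M)) \<le> L * B ^ 3 * (B ^ 3) ^ M" for M
  proof -
    have "ln (real (D M)) = (\<Sum>n\<le>Suc M. \<Sum>m<n. ln (real (\<mu> m n)))"
    proof -
      have pos: "real (\<mu> m n) \<noteq> 0" if "m < n" for m n using \<mu>0[OF that] by simp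
      have "ln (real (D M)) = (\<Sum>n\<le>Suc M. ln (\<Prod>m<n. real (\<mu> m n)))"
        unfolding D_def of_nat_prod
      proof (rule ln_prod)
        fix n
        assume "n \<in> {..Suc M}"
        show "(\<Prod>m<n. real (\<mu> m n)) \<noteq> 0" using pos by simp
      qed simp
      also have "\<dots> = (\<Sum>n\<le>Suc M. \<Sum>m<n. ln (real (\<mu> m n)))"
        by (rule sum.cong[OF refl], rule ln_prod) (simp_all only: lessThan_iff pos finite_lessThan not_False_eq_True)
      finally show ?thesis .
    qed
    also have "\<dots> \<le> (\<Sum>n\<le>Suc M. \<Sum>m<n. L * B ^ Suc M)"
      by (intro sum_mono ln\<mu>) auto
    also have "\<dots> \<le> (\<Sum>n\<le>Suc M. (real M + 2) * (L * B ^ Suc M))"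
      using L B by (intro sum_mono) (auto intro!: mult_right_mono)
    also have "\<dots> = (real M + 2)\<^sup>2 * (L * B ^ Suc M)" by (simp add: power2_eq_square)
    also have "\<dots> \<le> (B ^ Suc M)\<^sup>2 * (L * B ^ Suc M)"
    proof -
      \<comment> \<open>\<open>B \<ge> 2\<close> makes one power of \<open>B\<close> dominate each linear factor.\<close>
      have "M + 2 \<le> 2 ^ Suc M" by (induction M) auto
      hence "real M + 2 \<le> 2 ^ Suc M" by (metis of_nat_add of_nat_le_iff of_nat_numeral of_nat_power)
      also have "\<dots> \<le> B ^ Suc M" using B by (intro power_mono) auto
      finally show ?thesis using L B by (intro mult_right_mono power_mono) auto
    qed
    also have "\<dots> = L * B ^ 3 * (B ^ 3) ^ M"
      by (simp add: power2_eq_square power3_eq_cube power_mult_distrib)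
    finally show ?thesis .
  qed
  have size: "enat (Suc M) \<le> orbit_size_mod N d F P p"
    if p: "Factorial_Ring.prime p" "\<not> p dvd D M" for p M
  proof (rule orbit_size_mod_ge[OF p(1) homG G_def gcd aP])
    fix m n assume mn: "m < n" "n \<le> Suc M"
    have "\<mu> m n dvd (\<Prod>m<n. \<mu> m n)" using mn by (intro dvd_prodI) auto
    also have "\<dots> dvd D M" unfolding D_def using mn by (intro dvd_prodI) auto
    finally have "\<not> p dvd \<mu> m n" using p(2) dvd_trans by blast
    hence "\<not> int p dvd minor m n (k m n) (l m n)"
      by (simp add: \<mu>_def int_dvd_int_iff [symmetric])
    thus "\<exists>k\<le>N. \<exists>l\<le>N. \<not> int p dvd int_orbit G a m k * int_orbit G a n l - int_orbit G a m l * int_orbit G a n k"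
      using kl[OF mn(1)] unfolding minor_def u_def by blast
  qed
  show ?thesis
  proof (rule that[of "L * B ^ 3" "B ^ 3" D])
    show "L * B ^ 3 \<ge> 0" using L B by simp
    show "B ^ 3 > 1" using B by (intro one_less_power) auto
    show "D M > 0" for M by (rule D0)
    show "ln (real (D M)) \<le> L * B ^ 3 * (B ^ 3) ^ M" for M by (rule lnD)
    show "enat (Suc M) \<le> orbit_size_mod N d F P p"
      if "Factorial_Ring.prime p" "\<not> p dvd D M" for M p using that by (rule size)
  qed
qed

section \<open>Density of primes with a small orbit\<close>

text \<open>
  Group the primes by the value \<open>m\<close> of \<open>f\<close>.  A prime with value \<open>m\<close> divides \<open>D m\<close>, which bounds the
  sum of \<open>ln p\<close> in the group by \<open>K R\<^sup>m\<close>; being small compared with \<open>\<epsilon> ln p\<close> forces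
  \<open>1/p \<le> exp (- m/\<epsilon>)\<close>.  The groups are thus dominated by a geometric series.
\<close>

lemma summable_primes_with_small_value:
  fixes f :: "nat \<Rightarrow> enat" and D :: "nat \<Rightarrow> nat" and K R \<epsilon> :: real
  assumes "K \<ge> 0" "R > 1" and D0: "\<And>M. D M > 0" and lnD: "\<And>M. ln (real (D M)) \<le> K * R ^ M"
    and f: "\<And>M p. Factorial_Ring.prime p \<Longrightarrow> \<not> p dvd D M \<Longrightarrow> enat (Suc M) \<le> f p"
    and \<epsilon>: "\<epsilon> > 0" "\<epsilon> * ln R < 1"
  shows "summable (\<lambda>p. if Factorial_Ring.prime p \<and> \<not> ereal (\<epsilon> * ln (real p)) \<le> ereal_of_enat (f p)
           then ln (real p) / real p else 0)"
proof -
  define S where "S = {p. Factorial_Ring.prime p \<and> \<not> ereal (\<epsilon> * ln (real p)) \<le> ereal_of_enat (f p)}"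
  \<comment> \<open>The condition \<open>\<epsilon> ln R < 1\<close> says exactly that this ratio is below \<open>1\<close>.\<close>
  define q where "q = R * exp (- 1 / \<epsilon>)"
  have q: "0 < q" "q < 1"
  proof -
    show "0 < q" using assms(2) by (simp add: q_def)
    have "ln R < 1 / \<epsilon>" using \<epsilon> by (simp add: field_simps)
    hence "exp (ln R) < exp (1 / \<epsilon>)" by (simp only: exp_less_cancel_iff)
    hence "R < exp (1 / \<epsilon>)" using assms(2) by simp
    moreover have "q = R / exp (1 / \<epsilon>)" by (simp add: q_def exp_minus divide_inverse)
    ultimately show "q < 1" by simp
  qed
  define size where "size = (\<lambda>p. the_enat (f p))"
  have S: "Factorial_Ring.prime p" "p dvd D (size p)" "1 / real p \<le> exp (- 1 / \<epsilon>) ^ size p"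
    if "p \<in> S" for p
  proof -
    show p: "Factorial_Ring.prime p" using that by (simp add: S_def)
    have lt: "ereal_of_enat (f p) < ereal (\<epsilon> * ln (real p))" using that unfolding S_def not_le by blast
    hence fp: "f p = enat (size p)" by (cases "f p") (auto simp: size_def)
    show "p dvd D (size p)" using f[OF p, of "size p"] unfolding fp by auto
    have "real (size p) < \<epsilon> * ln (real p)" using lt unfolding fp by simp
    hence "real (size p) / \<epsilon> \<le> ln (real p)" using \<epsilon> by (simp add: field_simps)
    moreover have p0: "real p > 0" using prime_gt_0_nat[OF p] by simp
    ultimately have "exp (real (size p) / \<epsilon>) \<le> real p" by (simp only: ln_ge_iff)
    hence "1 / real p \<le> 1 / exp (real (size p) / \<epsilon>)" using p0 by (intro divide_left_mono) auto
    also have "\<dots> = exp (- (real (size p) / \<epsilon>))" by (simp only: exp_minus inverse_eq_divide)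
    also have "- (real (size p) / \<epsilon>) = real (size p) * (- 1 / \<epsilon>)" by simp
    also have "exp \<dots> = exp (- 1 / \<epsilon>) ^ size p" by (rule exp_of_nat_mult)
    finally show "1 / real p \<le> exp (- 1 / \<epsilon>) ^ size p" .
  qed
  have "summable (\<lambda>p. if p \<in> S then ln (real p) / real p else 0)"
  proof (rule summableI_nonneg_bounded)
    show "0 \<le> (if p \<in> S then ln (real p) / real p else 0)" for p
      by (cases "p = 0") auto
    fix n
    define Y where "Y = S \<inter> {..<n}"
    have fin: "finite Y" by (simp add: Y_def)
    have "(\<Sum>p<n. if p \<in> S then ln (real p) / real p else 0) = (\<Sum>p\<in>Y. ln (real p) / real p)"
      unfolding Y_def by (subst Int_commute) (rule sum.inter_restrict [symmetric], simp)
    also have "\<dots> = (\<Sum>m\<in>size ` Y. \<Sum>p\<in>{p \<in> Y. size p = m}. ln (real p) / real p)"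
      by (rule sum.image_gen[OF fin])
    also have "\<dots> \<le> (\<Sum>m\<in>size ` Y. K * q ^ m)"
    proof (rule sum_mono)
      fix m
      have "(\<Sum>p\<in>{p \<in> Y. size p = m}. ln (real p) / real p)
          \<le> (\<Sum>p\<in>{p \<in> Y. size p = m}. exp (- 1 / \<epsilon>) ^ m * ln (real p))"
      proof (rule sum_mono)
        fix p assume "p \<in> {p \<in> Y. size p = m}"
        hence p: "p \<in> S" "size p = m" by (auto simp: Y_def)
        have "ln (real p) \<ge> 0" using prime_gt_0_nat[OF S(1)[OF p(1)]] by simp
        from mult_right_mono[OF S(3)[OF p(1)] this] p(2)
        show "ln (real p) / real p \<le> exp (- 1 / \<epsilon>) ^ m * ln (real p)" by simp
      qed
      also have "\<dots> = exp (- 1 / \<epsilon>) ^ m * (\<Sum>p\<in>{p \<in> Y. size p = m}. ln (real p))"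
        by (rule sum_distrib_left [symmetric])
      also have "\<dots> \<le> exp (- 1 / \<epsilon>) ^ m * (K * R ^ m)"
      proof (rule mult_left_mono)
        have "(\<Sum>p\<in>{p \<in> Y. size p = m}. ln (real p)) \<le> ln (real (D m))"
          using fin S D0 by (intro sum_ln_prime_divisors_le) (auto simp: Y_def)
        thus "(\<Sum>p\<in>{p \<in> Y. size p = m}. ln (real p)) \<le> K * R ^ m" using lnD[of m] by simp
      qed simp
      also have "\<dots> = K * q ^ m" by (simp add: q_def power_mult_distrib)
      finally show "(\<Sum>p\<in>{p \<in> Y. size p = m}. ln (real p) / real p) \<le> K * q ^ m" .
    qed
    also have "\<dots> \<le> suminf (\<lambda>m. K * q ^ m)"
      using q assms(1) fin by (intro sum_le_suminf summable_mult summable_geometric) auto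
    finally show "(\<Sum>p<n. if p \<in> S then ln (real p) / real p else 0) \<le> suminf (\<lambda>m. K * q ^ m)" .
  qed
  thus ?thesis by (simp add: S_def)
qed

theorem theorem1:
  fixes N d :: nat
    and F :: "nat \<Rightarrow> rat mpoly"
    and P :: "(nat \<Rightarrow> rat) set"
  assumes "proj_morphism N d rat_field F"
    and "P \<in> proj_space N rat_field"
    and "infinite (forward_orbit (proj_map N rat_field F) P)"
  shows "(\<forall>\<gamma>::real. \<gamma> < 1 \<longrightarrow>
            has_density {p. Factorial_Ring.prime p \<and>
              ereal_of_enat (orbit_size_mod N d F P p) \<ge> ereal (ln (real p) powr \<gamma>)} 1) \<and>
         (\<exists>C::real. \<forall>\<epsilon>::real. \<epsilon> > 0 \<longrightarrow>
            lower_density {p. Factorial_Ring.prime p \<and>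
              ereal_of_enat (orbit_size_mod N d F P p) \<ge> ereal (\<epsilon> * ln (real p))}
            \<ge> ereal (1 - C * \<epsilon>))"
proof -
  define f where "f = orbit_size_mod N d F P"
  define A where "A = (\<lambda>r :: nat \<Rightarrow> real. {p. Factorial_Ring.prime p \<and> ereal_of_enat (f p) \<ge> ereal (r p)})"
  have A_primes: "A r \<subseteq> primes" for r by (auto simp: A_def)
  have mem: "p \<in> primes - A r \<longleftrightarrow> Factorial_Ring.prime p \<and> \<not> ereal (r p) \<le> ereal_of_enat (f p)" for p r
    by (auto simp: A_def)
  obtain D :: "nat \<Rightarrow> nat" and K R :: real where KR: "K \<ge> 0" "R > 1" "\<And>M. D M > 0"
    "\<And>M. ln (real (D M)) \<le> K * R ^ M"
    "\<And>M p. Factorial_Ring.prime p \<Longrightarrow> \<not> p dvd D M \<Longrightarrow> enat (Suc M) \<le> f p"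
    unfolding f_def using collision_numbers[OF assms] by metis
  have small: "summable (\<lambda>p. if p \<in> primes - A (\<lambda>p. \<epsilon> * ln (real p)) then ln (real p) / real p else 0)"
    if "\<epsilon> > 0" "\<epsilon> * ln R < 1" for \<epsilon>
    unfolding mem by (rule summable_primes_with_small_value[OF KR that])
  have lnR: "ln R > 0" using KR by simp
  have part_a: "has_density (A (\<lambda>p. ln (real p) powr \<gamma>)) 1" if \<gamma>: "\<gamma> < 1" for \<gamma>
    unfolding has_density_def
  proof (rule log_deriv_ratio_tendsto_1[OF A_primes])
    \<comment> \<open>Any value below \<open>1 / ln R\<close> would do.\<close>
    define \<epsilon> where "\<epsilon> = 1 / (2 * ln R)"
    have \<epsilon>: "\<epsilon> > 0" "\<epsilon> * ln R < 1" using lnR by (simp_all add: \<epsilon>_def)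
    have "((\<lambda>x::real. x powr (\<gamma> - 1)) \<longlongrightarrow> 0) at_top"
      using \<gamma> by (intro tendsto_neg_powr filterlim_ident) auto
    hence "eventually (\<lambda>x::real. x powr (\<gamma> - 1) < \<epsilon>) at_top" using \<epsilon>(1) by (rule order_tendstoD)
    hence "eventually (\<lambda>x::real. x powr \<gamma> \<le> \<epsilon> * x) at_top"
      using eventually_gt_at_top[of 0]
    proof eventually_elim
      case (elim x)
      have "x powr \<gamma> = x powr (\<gamma> - 1) * x" using elim(2) by (simp add: powr_diff)
      thus ?case using elim by simp
    qed
    moreover have "filterlim (\<lambda>p. ln (real p)) at_top sequentially"
      by (rule filterlim_compose[OF ln_at_top filterlim_real_sequentially])
    ultimately have "eventually (\<lambda>p. ln (real p) powr \<gamma> \<le> \<epsilon> * ln (real p)) sequentially"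
      by (rule eventually_compose_filterlim)
    hence "eventually (\<lambda>p. norm (if p \<in> primes - A (\<lambda>p. ln (real p) powr \<gamma>) then ln (real p) / real p else 0)
        \<le> (if p \<in> primes - A (\<lambda>p. \<epsilon> * ln (real p)) then ln (real p) / real p else 0)) sequentially"
      using eventually_gt_at_top[of 0]
    proof eventually_elim
      case (elim p)
      have "p \<in> primes - A (\<lambda>p. \<epsilon> * ln (real p))" if "p \<in> primes - A (\<lambda>p. ln (real p) powr \<gamma>)"
      proof -
        have "ereal (ln (real p) powr \<gamma>) \<le> ereal (\<epsilon> * ln (real p))" using elim(1) by simp
        thus ?thesis using that order_trans unfolding mem by blast
      qed
      moreover have "ln (real p) / real p \<ge> 0" using elim(2) by simp
      ultimately show ?case by auto
    qed
    thus "summable (\<lambda>p. if p \<in> primes - A (\<lambda>p. ln (real p) powr \<gamma>) then ln (real p) / real p else 0)"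
      by (rule summable_comparison_test_ev) (rule small[OF \<epsilon>])
  qed
  have part_b: "lower_density (A (\<lambda>p. \<epsilon> * ln (real p))) \<ge> ereal (1 - ln R * \<epsilon>)" if \<epsilon>: "\<epsilon> > 0" for \<epsilon>
  proof (cases "\<epsilon> * ln R < 1")
    case True
    have "((\<lambda>s. ereal (log_deriv_ratio (A (\<lambda>p. \<epsilon> * ln (real p))) s)) \<longlongrightarrow> ereal 1) (at_right 1)"
      using log_deriv_ratio_tendsto_1[OF A_primes small[OF \<epsilon> True]] by simp
    hence "lower_density (A (\<lambda>p. \<epsilon> * ln (real p))) = ereal 1"
      unfolding lower_density_def by (intro lim_imp_Liminf) auto
    moreover have "ln R * \<epsilon> \<ge> 0" using lnR \<epsilon> by simp
    ultimately show ?thesis by simp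
  next
    case False
    hence "ereal (1 - ln R * \<epsilon>) \<le> 0" by (simp add: mult.commute)
    also have "\<dots> \<le> lower_density (A (\<lambda>p. \<epsilon> * ln (real p)))" by (rule lower_density_nonneg[OF A_primes])
    finally show ?thesis .
  qed
  show ?thesis using part_a part_b unfolding A_def f_def by blast
qed

end
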